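(* There is a constant $c>0$ such that the following holds. Let $n\in\mathbb{N}$ and $\rho\in(0,1)$, and consider the $n\times n$ input-queued switch (described in the context) whose $n^2$ arrival streams are independent Bernoulli processes with common rate $\rho/n$, started empty. Then there exists a scheduling policy under which, for every time slot $\tau\in\mathbb{N}$, \[ \mathbb{E}\Big[\sum_{i,j=1}^n Q_{ij}(\tau)\Big]\le c\, n\,(1-\rho)^{-4/3}\log f,\qquad\text{where } f=\max\Big\{n,\frac{1}{1-\rho}\Big\}. \] The constant $c$ does not depend on $n$, $\rho$ or $\tau$.
   Context: An $n\times n$ input-queued switch consists of $n^2$ queues indexed by pairs $(i,j)$, $i,j\in[n]=\{1,\dots,n\}$, operating in discrete time slots $\tau\in\mathbb{N}$. Let $A_{ij}(\tau)$ be the cumulative number of arrivals to queue $(i,j)$ in slots $1,\dots,\tau$, with $A_{ij}(0)=0$; the increments $A_{ij}(\tau)-A_{ij}(\tau-1)$ are independent (over $i,j,\tau$) Bernoulli random variables with mean $\rho/n$. The set of feasible schedules is $\mathcal{S}=\{\sigma\in\{0,1\}^{n\times n}: \sum_{j'}\sigma_{ij'}\le 1\ \forall i,\ \sum_{i'}\sigma_{i'j}\le1\ \forall j\}$ (partial matchings). $Q_{ij}(\tau)$ is the size of queue $(i,j)$ at the beginning of slot $\tau$, with $Q_{ij}(1)=0$. In slot $\tau$ a scheduling policy observes the queue sizes (and the past history) and chooses $\sigma(\tau)\in\mathcal{S}$; then $Q_{ij}(\tau+1)=(Q_{ij}(\tau)-\sigma_{ij}(\tau))^+ + A_{ij}(\tau)-A_{ij}(\tau-1)$.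 A scheduling policy is any rule choosing $\sigma(\tau)$ based on the past history and current queue sizes (it may depend on the known parameters $n$ and $\rho$). *)

theory Defs
  imports "HOL-Probability.Probability"
begin

text \<open>Arrival sample paths: arr (t, i, j) is True iff one packet arrives to
queue (i,j) in slot t (i.e. A_ij(t) - A_ij(t-1) = 1).
Schedules: sigma i j (True iff sigma_ij = 1).\<close>

type_synonym arrivals = "nat \<times> nat \<times> nat \<Rightarrow> bool"
type_synonym schedule = "nat \<Rightarrow> nat \<Rightarrow> bool"
type_synonym queues = "nat \<Rightarrow> nat \<Rightarrow> nat"

text \<open>A (deterministic) scheduling policy: in slot tau it receives the arrival
history (arrivals of slots 1..tau-1, see truncate_hist) and the current queue sizes.\<close>
type_synonym policy = "nat \<Rightarrow> arrivals \<Rightarrow> queues \<Rightarrow> schedule"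

definition truncate_hist :: "nat \<Rightarrow> arrivals \<Rightarrow> arrivals" where
  "truncate_hist tau a = (\<lambda>(t, i, j). t < tau \<and> a (t, i, j))"

definition feasible_schedule :: "nat \<Rightarrow> schedule \<Rightarrow> bool" where
  "feasible_schedule n s \<longleftrightarrow>
     (\<forall>i j. s i j \<longrightarrow> i \<in> {1..n} \<and> j \<in> {1..n}) \<and>
     (\<forall>i. card {j. s i j} \<le> 1) \<and> (\<forall>j. card {i. s i j} \<le> 1)"

definition valid_policy :: "nat \<Rightarrow> policy \<Rightarrow> bool" where
  "valid_policy n pol \<longleftrightarrow> (\<forall>tau h q. feasible_schedule n (pol tau h q))"

text \<open>qstate pol a k = Q(k+1), the queue vector at the beginning of slot k+1.\<close>
fun qstate :: "policy \<Rightarrow> arrivals \<Rightarrow> nat \<Rightarrow> queues" where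
  "qstate pol a 0 = (\<lambda>i j. 0)"
| "qstate pol a (Suc k) =
     (let tau = Suc k; q = qstate pol a k; s = pol tau (truncate_hist tau a) q
      in (\<lambda>i j. (q i j - (if s i j then 1 else 0)) + (if a (tau, i, j) then 1 else 0)))"

definition Q :: "policy \<Rightarrow> arrivals \<Rightarrow> nat \<Rightarrow> queues" where
  "Q pol a tau = qstate pol a (tau - 1)"

text \<open>Law of the arrivals in slots 1..tau-1 for the n x n switch: independent
Bernoulli(rho/n) increments (all other coordinates are False).  Q(tau) only
depends on these slots.\<close>
definition arrival_law :: "nat \<Rightarrow> real \<Rightarrow> nat \<Rightarrow> arrivals pmf" where
  "arrival_law n rho tau =
     Pi_pmf ({1..<tau} \<times> {1..n} \<times> {1..n}) False (\<lambda>_. bernoulli_pmf (rho / real n))"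

definition expected_total_queue :: "nat \<Rightarrow> real \<Rightarrow> policy \<Rightarrow> nat \<Rightarrow> real" where
  "expected_total_queue n rho pol tau =
     measure_pmf.expectation (arrival_law n rho tau)
       (\<lambda>a. real (\<Sum>i\<in>{1..n}. \<Sum>j\<in>{1..n}. Q pol a tau i j))"

end

theory Submission
  imports Defs
begin

text \<open>Write \<open>\<epsilon> = 1 - \<rho>\<close> and \<open>L = ln f\<close>. Time is cut into windows of \<open>d \<approx> L \<epsilon>\<^sup>-\<^sup>4\<^sup>/\<^sup>3\<close> slots. Given the cut condition
  for factors of bipartite multigraphs, a Chernoff and union bound shows that the arrivals of a window contain
  a \<open>\<kappa>\<close>-factor with \<open>d - \<kappa> = O (\<epsilon> d + sqrt (d L))\<close>, except with probability at most a high power of \<open>1 / f\<close>. The factor splits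
  into \<open>\<kappa>\<close> perfect matchings, which are served without waste in the next window. Over a batch of
  \<open>B d \<approx> L \<epsilon>\<^sup>-\<^sup>2\<close> slots every port receives fewer than \<open>B d\<close> packets, so what the factors
  leave behind has degree below \<open>S = B (d - \<kappa>)\<close>, the number of slots left free by the factors of
  the next batch, and can be cleared there by Koenig's theorem. At any time about \<open>n (d + S)\<close>
  packets are present, and the choice of \<open>d\<close> balances \<open>d\<close> against \<open>S \<approx> L\<^sup>3\<^sup>/\<^sup>2 \<epsilon>\<^sup>-\<^sup>2 d\<^sup>-\<^sup>1\<^sup>/\<^sup>2\<close>.
  A failed batch delays at most \<open>n B d\<close> units of degree, which the one spare unit gained in every good batch
  works off; an exponential Lyapunov function makes this contribution negligible.\<close>

section \<open>Factors of bipartite multigraphs\<close>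

text \<open>Cell by cell, the indicators of the four rectangles satisfy the inequality. It serves to
  uncross two tight pairs.\<close>

lemma sum_bilinear_submodular:
  fixes M :: "'a \<Rightarrow> 'b \<Rightarrow> nat"
  assumes "finite I" "finite J" "X \<subseteq> I" "X' \<subseteq> I" "Y \<subseteq> J" "Y' \<subseteq> J"
  shows "(\<Sum>i\<in>X \<union> X'. \<Sum>j\<in>Y \<inter> Y'. M i j) + (\<Sum>i\<in>X \<inter> X'. \<Sum>j\<in>Y \<union> Y'. M i j)
     \<le> (\<Sum>i\<in>X. \<Sum>j\<in>Y. M i j) + (\<Sum>i\<in>X'. \<Sum>j\<in>Y'. M i j)"
proof -
  have e: "(\<Sum>i\<in>U. \<Sum>j\<in>V. M i j) = (\<Sum>(i,j)\<in>I \<times> J. M i j * of_bool (i \<in> U \<and> j \<in> V))"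
    if "U \<subseteq> I" "V \<subseteq> J" for U V
  proof -
    have "finite U" "finite V"
      using that assms finite_subset by blast+
    hence "(\<Sum>i\<in>U. \<Sum>j\<in>V. M i j) = (\<Sum>(i,j)\<in>U \<times> V. M i j)"
      by (simp add: sum.cartesian_product)
    also have "\<dots> = (\<Sum>(i,j)\<in>I \<times> J. M i j * of_bool (i \<in> U \<and> j \<in> V))"
      using that assms by (intro sum.mono_neutral_cong_left) auto
    finally show ?thesis .
  qed
  show ?thesis
    using assms
    by (subst (1 2 3 4) e)
      (auto simp flip: sum.distrib intro!: sum_mono)
qed

text \<open>The induction removes a single unit of flow through a cell \<open>(i\<^sub>0, j\<^sub>0)\<close>; this is safe when
  \<open>j\<^sub>0\<close> lies in every column set \<open>Y\<close> of a tight pair \<open>(X, Y)\<close> with \<open>i\<^sub>0 \<notin> X\<close>, and by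
  submodularity there is a smallest such \<open>Y\<close>.\<close>

lemma bounded_matrix_with_margins:
  fixes M :: "'a \<Rightarrow> 'b \<Rightarrow> nat" and r :: "'a \<Rightarrow> nat" and c :: "'b \<Rightarrow> nat"
  assumes "finite I" "finite J" "sum r I = sum c J"
    and "\<And>X Y. X \<subseteq> I \<Longrightarrow> Y \<subseteq> J \<Longrightarrow> sum r X \<le> (\<Sum>i\<in>X. \<Sum>j\<in>Y. M i j) + sum c (J - Y)"
  shows "\<exists>F. (\<forall>i\<in>I. \<forall>j\<in>J. F i j \<le> M i j) \<and>
    (\<forall>i\<in>I. (\<Sum>j\<in>J. F i j) = r i) \<and> (\<forall>j\<in>J. (\<Sum>i\<in>I. F i j) = c j)"
  using assms(3,4)
proof (induction "sum r I" arbitrary: M r c)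
  case 0
  with assms(1,2) show ?case
    by (intro exI[of _ "\<lambda>_ _. 0"]) auto
next
  case (Suc s)
  define e where "e X Y = (\<Sum>i\<in>X. \<Sum>j\<in>Y. M i j)" for X Y
  note cut = Suc.prems(2)[folded e_def]
  from Suc.hyps(2) obtain i0 where i0: "i0 \<in> I" "r i0 > 0"
    by (metis Zero_not_Suc gr0I sum.neutral)
  define tight where "tight X Y \<longleftrightarrow> X \<subseteq> I \<and> Y \<subseteq> J \<and> i0 \<notin> X \<and> sum r X = e X Y + sum c (J - Y)" for X Y
  have "\<exists>Y X. tight X Y"
    by (intro exI[of _ J] exI[of _ "{}"]) (auto simp: tight_def e_def)
  \<comment> \<open>Minimality is by cardinality only; \<open>Y0_least\<close> upgrades it to
    inclusion.\<close>
  then obtain Y0 where Y0: "\<exists>X. tight X Y0" and minY: "\<And>Y. \<exists>X. tight X Y \<Longrightarrow> card Y0 \<le> card Y"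
    using ex_has_least_nat[of "\<lambda>Y. \<exists>X. tight X Y" _ card] by metis
  then obtain X0 where X0: "tight X0 Y0" by blast
  have fin: "finite X" if "X \<subseteq> I" for X using that assms(1) finite_subset by blast
  have fin': "finite X" if "X \<subseteq> J" for X using that assms(2) finite_subset by blast
  have Y0_least: "Y0 \<subseteq> Y" if t: "tight X Y" for X Y
  proof -
    have sub: "X \<subseteq> I" "X0 \<subseteq> I" "Y \<subseteq> J" "Y0 \<subseteq> J" "i0 \<notin> X" "i0 \<notin> X0"
      using t X0 by (auto simp: tight_def)
    \<comment> \<open>Uncrossing: the two new cut inequalities have the same total left side as the
      two tight equalities and no larger total right side, so both are equalities and
      \<open>Y0 \<inter> Y\<close> belongs to a tight pair.\<close>
    have "e (X0 \<union> X) (Y0 \<inter> Y) + e (X0 \<inter> X) (Y0 \<union> Y) \<le> e X0 Y0 + e X Y"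
      unfolding e_def using sub assms by (intro sum_bilinear_submodular[of I J]) auto
    moreover have "sum r (X0 \<union> X) + sum r (X0 \<inter> X) = sum r X0 + sum r X"
      using sub fin by (intro sum.union_inter) auto
    moreover have "sum c (J - (Y0 \<inter> Y)) + sum c (J - (Y0 \<union> Y)) = sum c (J - Y0) + sum c (J - Y)"
    proof -
      have "J - (Y0 \<inter> Y) = (J - Y0) \<union> (J - Y)" "J - (Y0 \<union> Y) = (J - Y0) \<inter> (J - Y)" by auto
      thus ?thesis using assms by (simp only:) (intro sum.union_inter, auto)
    qed
    moreover have "sum r (X0 \<union> X) \<le> e (X0 \<union> X) (Y0 \<inter> Y) + sum c (J - (Y0 \<inter> Y))"
      using sub by (intro cut) auto
    moreover have "sum r (X0 \<inter> X) \<le> e (X0 \<inter> X) (Y0 \<union> Y) + sum c (J - (Y0 \<union> Y))"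
      using sub by (intro cut) auto
    ultimately have "tight (X0 \<union> X) (Y0 \<inter> Y)"
      using t X0 sub unfolding tight_def by auto
    hence "card Y0 \<le> card (Y0 \<inter> Y)" using minY by blast
    thus ?thesis
      using fin'[OF sub(4)] by (metis Int_lower1 card_seteq inf.absorb_iff1)
  qed
  have "\<exists>j0\<in>Y0. M i0 j0 > 0"
  proof -
    have sub: "X0 \<subseteq> I" "Y0 \<subseteq> J" "i0 \<notin> X0" using X0 by (auto simp: tight_def)
    \<comment> \<open>Compared with the tight equality for \<open>(X0, Y0)\<close>, the extra demand
      \<open>r i0 > 0\<close> can only be covered by cells from \<open>i0\<close> into
      \<open>Y0\<close>.\<close>
    have "sum r (insert i0 X0) \<le> e (insert i0 X0) Y0 + sum c (J - Y0)"
      using i0 sub by (intro cut) auto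
    hence "r i0 \<le> (\<Sum>j\<in>Y0. M i0 j)"
      using X0 sub fin[OF sub(1)] by (simp add: e_def tight_def)
    with i0 show ?thesis
      by (metis leD not_gr_zero sum.neutral)
  qed
  then obtain j0 where j0: "j0 \<in> Y0" "M i0 j0 > 0" by blast
  have j0J: "j0 \<in> J" using j0 X0 by (auto simp: tight_def)
  have cj0: "c j0 > 0"
  proof (rule ccontr)
    assume "\<not> c j0 > 0"
    \<comment> \<open>With \<open>c j0 = 0\<close> the columns other than \<open>j0\<close> would
      form a tight pair with no rows, so \<open>Y0\<close> would miss \<open>j0\<close>.\<close>
    hence "tight {} (J - {j0})"
      using j0J by (auto simp: tight_def e_def Diff_Diff_Int)
    from Y0_least[OF this] j0 show False by auto
  qed
  define M' where "M' i j = M i j - of_bool (i = i0 \<and> j = j0)" for i j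
  define r' where "r' i = r i - of_bool (i = i0)" for i
  define c' where "c' j = c j - of_bool (j = j0)" for j
  have r: "sum r X = sum r' X + of_bool (i0 \<in> X)" if "X \<subseteq> I" for X
  proof -
    have "sum r X = (\<Sum>i\<in>X. r' i + of_bool (i = i0))"
      using i0 by (intro sum.cong) (auto simp: r'_def)
    thus ?thesis using fin[OF that] by (simp add: sum.distrib)
  qed
  have c: "sum c Y = sum c' Y + of_bool (j0 \<in> Y)" if "Y \<subseteq> J" for Y
  proof -
    have "sum c Y = (\<Sum>i\<in>Y. c' i + of_bool (i = j0))"
      using cj0 by (intro sum.cong) (auto simp: c'_def)
    thus ?thesis using fin'[OF that] by (simp add: sum.distrib)
  qed
  have delta: "(\<Sum>i\<in>X. \<Sum>j\<in>Y. of_bool (i = i0 \<and> j = j0)) = (of_bool (i0 \<in> X \<and> j0 \<in> Y) :: nat)"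
    if "X \<subseteq> I" "Y \<subseteq> J" for X Y
  proof -
    have "(\<Sum>i\<in>X. \<Sum>j\<in>Y. of_bool (i = i0 \<and> j = j0)) = (\<Sum>i\<in>X. of_bool (i = i0 \<and> j0 \<in> Y) :: nat)"
      using fin'[OF that(2)] by (intro sum.cong) auto
    thus ?thesis using fin[OF that(1)] by auto
  qed
  have e: "e X Y = (\<Sum>i\<in>X. \<Sum>j\<in>Y. M' i j) + of_bool (i0 \<in> X \<and> j0 \<in> Y)"
    if "X \<subseteq> I" "Y \<subseteq> J" for X Y
  proof -
    have "e X Y = (\<Sum>i\<in>X. \<Sum>j\<in>Y. M' i j + of_bool (i = i0 \<and> j = j0))"
      unfolding e_def using j0 by (intro sum.cong) (auto simp: M'_def)
    thus ?thesis by (simp only: sum.distrib delta[OF that])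
  qed
  have "\<exists>F. (\<forall>i\<in>I. \<forall>j\<in>J. F i j \<le> M' i j) \<and>
    (\<forall>i\<in>I. (\<Sum>j\<in>J. F i j) = r' i) \<and> (\<forall>j\<in>J. (\<Sum>i\<in>I. F i j) = c' j)"
  proof (rule Suc.hyps(1))
    show "s = sum r' I" using r[of I] i0 Suc.hyps(2) by simp
    show "sum r' I = sum c' J" using r[of I] c[of J] i0 j0J Suc.prems(1) by simp
    fix X Y assume XY: "X \<subseteq> I" "Y \<subseteq> J"
    have *: "sum r X \<le> e X Y + sum c (J - Y)" using XY by (rule cut)
    \<comment> \<open>Removing the unit lowers the right side but not the left only if
      \<open>i0 \<notin> X\<close> and \<open>j0 \<notin> Y\<close>; there the cut is strict, as a
      tight \<open>Y\<close> would contain \<open>j0\<close>.\<close>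
    have **: "sum r X \<noteq> e X Y + sum c (J - Y)" if "i0 \<notin> X" "j0 \<notin> Y"
      using Y0_least[of X Y] XY j0 that by (auto simp: tight_def)
    show "sum r' X \<le> (\<Sum>i\<in>X. \<Sum>j\<in>Y. M' i j) + sum c' (J - Y)"
      using * ** r[OF XY(1)] e[OF XY] c[of "J - Y"] j0J
      by (cases "i0 \<in> X"; cases "j0 \<in> Y") auto
  qed
  then obtain F where F: "\<forall>i\<in>I. \<forall>j\<in>J. F i j \<le> M' i j"
    "\<forall>i\<in>I. (\<Sum>j\<in>J. F i j) = r' i" "\<forall>j\<in>J. (\<Sum>i\<in>I. F i j) = c' j" by blast
  have "(\<Sum>j\<in>J. F i j + of_bool (i = i0 \<and> j = j0)) = r i" if "i \<in> I" for i
    using F(2) that j0J i0 assms(2) by (cases "i = i0") (auto simp: sum.distrib r'_def)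
  moreover have "(\<Sum>i\<in>I. F i j + of_bool (i = i0 \<and> j = j0)) = c j" if "j \<in> J" for j
    using F(3) that j0J i0 assms(1) cj0 by (cases "j = j0") (auto simp: sum.distrib c'_def)
  moreover have "F i j + of_bool (i = i0 \<and> j = j0) \<le> M i j" if "i \<in> I" "j \<in> J" for i j
    using F(1) that j0 by (force simp: M'_def)
  ultimately show ?case by (intro exI[of _ "\<lambda>i j. F i j + of_bool (i = i0 \<and> j = j0)"]) blast
qed

section \<open>Maximum degree, and matchings that lower it\<close>

definition deg_le :: "nat \<Rightarrow> queues \<Rightarrow> nat \<Rightarrow> bool" where
  "deg_le n M D \<longleftrightarrow> (\<forall>i\<in>{1..n}. (\<Sum>j=1..n. M i j) \<le> D) \<and> (\<forall>j\<in>{1..n}. (\<Sum>i=1..n. M i j) \<le> D)"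

lemma deg_le_mono: "deg_le n M D \<Longrightarrow> D \<le> D' \<Longrightarrow> deg_le n M D'"
  unfolding deg_le_def by (meson order.trans)

lemma deg_le_mono': "deg_le n M D \<Longrightarrow> (\<And>i j. M' i j \<le> M i j) \<Longrightarrow> deg_le n M' D"
  unfolding deg_le_def by (meson order.trans sum_mono)

lemma deg_le_add: "deg_le n M D \<Longrightarrow> deg_le n M' D' \<Longrightarrow> deg_le n (\<lambda>i j. M i j + M' i j) (D + D')"
  unfolding deg_le_def by (simp add: sum.distrib add_mono)

text \<open>Koenig's edge-colouring step: pad the matrix to a \<open>D\<close>-regular one and take a 1-factor.\<close>

lemma matching_reduces_degree:
  assumes deg: "deg_le n M D" and D: "D > 0"
  shows "\<exists>s. feasible_schedule n s \<and> (\<forall>i j. s i j \<longrightarrow> 0 < M i j) \<and>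
    deg_le n (\<lambda>i j. M i j - of_bool (s i j)) (D - 1)"
proof -
  let ?I = "{1..n}"
  define r where "r i = (\<Sum>j=1..n. M i j)" for i
  define c where "c j = (\<Sum>i=1..n. M i j)" for j
  have r: "r i \<le> D" if "i \<in> ?I" for i using deg that by (auto simp: deg_le_def r_def)
  have c: "c j \<le> D" if "j \<in> ?I" for j using deg that by (auto simp: deg_le_def c_def)
  have rc: "sum r ?I = sum c ?I" unfolding r_def c_def by (rule sum.swap)
  \<comment> \<open>\<open>Z\<close> supplies the missing degrees. A single cell of capacity
    \<open>n * D\<close> already holds the total deficiency, so capacities never obstruct.\<close>
  have "\<exists>Z. (\<forall>i\<in>?I. \<forall>j\<in>?I. Z i j \<le> n * D) \<and>
    (\<forall>i\<in>?I. (\<Sum>j\<in>?I. Z i j) = D - r i) \<and> (\<forall>j\<in>?I. (\<Sum>i\<in>?I. Z i j) = D - c j)"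
  proof (rule bounded_matrix_with_margins)
    show eq: "(\<Sum>i\<in>?I. D - r i) = (\<Sum>i\<in>?I. D - c i)"
      using sum_subtractf_nat[of ?I r "\<lambda>_. D", OF r] sum_subtractf_nat[of ?I c "\<lambda>_. D", OF c] rc
      by metis
    fix X Y assume XY: "X \<subseteq> ?I" "Y \<subseteq> ?I"
    have le: "(\<Sum>i\<in>X. D - r i) \<le> (\<Sum>i\<in>?I. D - r i)" using XY by (intro sum_mono2) auto
    have fin: "finite X" "finite Y" using XY finite_subset by blast+
    show "(\<Sum>i\<in>X. D - r i) \<le> (\<Sum>i\<in>X. \<Sum>j\<in>Y. n * D) + (\<Sum>j\<in>?I - Y. D - c j)"
    proof (cases "X = {} \<or> Y = {}")
      case True thus ?thesis using le eq by auto
    next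
      case False
      hence "1 \<le> card X * card Y" using fin by (simp add: Suc_leI card_gt_0_iff)
      hence "1 * (n * D) \<le> card X * card Y * (n * D)" by (rule mult_right_mono) auto
      also have "\<dots> = (\<Sum>i\<in>X. \<Sum>j\<in>Y. n * D)" by simp
      finally have "n * D \<le> (\<Sum>i\<in>X. \<Sum>j\<in>Y. n * D)" by simp
      moreover have "(\<Sum>i\<in>?I. D - r i) \<le> n * D"
        using sum_bounded_above[of ?I "\<lambda>i. D - r i" D] by simp
      ultimately show ?thesis using le by linarith
    qed
  qed auto
  then obtain Z where Z: "\<And>i. i \<in> ?I \<Longrightarrow> (\<Sum>j\<in>?I. Z i j) = D - r i"
    "\<And>j. j \<in> ?I \<Longrightarrow> (\<Sum>i\<in>?I. Z i j) = D - c j" by blast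
  define W where "W i j = M i j + Z i j" for i j
  have Wr: "(\<Sum>j\<in>?I. W i j) = D" if "i \<in> ?I" for i
    using Z(1)[OF that] r[OF that] by (simp add: W_def sum.distrib r_def)
  have Wc: "(\<Sum>i\<in>?I. W i j) = D" if "j \<in> ?I" for j
    using Z(2)[OF that] c[OF that] by (simp add: W_def sum.distrib c_def)
  have "\<exists>F. (\<forall>i\<in>?I. \<forall>j\<in>?I. F i j \<le> W i j) \<and>
    (\<forall>i\<in>?I. (\<Sum>j\<in>?I. F i j) = 1) \<and> (\<forall>j\<in>?I. (\<Sum>i\<in>?I. F i j) = 1)"
  proof (rule bounded_matrix_with_margins)
    fix X Y assume XY: "X \<subseteq> ?I" "Y \<subseteq> ?I"
    \<comment> \<open>Hall's condition by counting the \<open>D * card X\<close> edges at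
      \<open>X\<close>: at most \<open>D\<close> of them end in each column outside
      \<open>Y\<close>.\<close>
    have "D * card X = (\<Sum>i\<in>X. \<Sum>j\<in>?I. W i j)" using XY Wr by (simp add: subset_iff)
    also have "\<dots> = (\<Sum>i\<in>X. (\<Sum>j\<in>Y. W i j) + (\<Sum>j\<in>?I-Y. W i j))"
    proof (rule sum.cong[OF refl])
      fix i
      have "(\<Sum>j\<in>?I. W i j) = (\<Sum>j\<in>?I-Y. W i j) + (\<Sum>j\<in>Y. W i j)"
        using XY by (intro sum.subset_diff) auto
      thus "(\<Sum>j\<in>?I. W i j) = (\<Sum>j\<in>Y. W i j) + (\<Sum>j\<in>?I-Y. W i j)" by linarith
    qed
    also have "\<dots> = (\<Sum>i\<in>X. \<Sum>j\<in>Y. W i j) + (\<Sum>j\<in>?I-Y. \<Sum>i\<in>X. W i j)"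
      by (simp add: sum.distrib sum.swap[of _ X])
    also have "(\<Sum>j\<in>?I-Y. \<Sum>i\<in>X. W i j) \<le> (\<Sum>j\<in>?I-Y. \<Sum>i\<in>?I. W i j)"
      using XY by (intro sum_mono sum_mono2) auto
    also have "\<dots> = D * card (?I - Y)" using Wc by simp
    finally have *: "D * card X \<le> (\<Sum>i\<in>X. \<Sum>j\<in>Y. W i j) + D * card (?I - Y)" by simp
    have "card X \<le> (\<Sum>i\<in>X. \<Sum>j\<in>Y. W i j) + card (?I - Y)"
    proof (cases "card X \<le> card (?I - Y)")
      case False
      then obtain q where q: "card X = card (?I - Y) + q" by (metis le_add_diff_inverse nat_le_linear)
      with * have "D * q \<le> (\<Sum>i\<in>X. \<Sum>j\<in>Y. W i j)" by (simp add: add_mult_distrib2)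
      moreover have "q \<le> D * q" using D by simp
      ultimately show ?thesis using q by linarith
    qed auto
    thus "(\<Sum>i\<in>X. 1) \<le> (\<Sum>i\<in>X. \<Sum>j\<in>Y. W i j) + (\<Sum>j\<in>?I-Y. 1)" by simp
  qed auto
  then obtain F where F: "\<And>i j. i \<in> ?I \<Longrightarrow> j \<in> ?I \<Longrightarrow> F i j \<le> W i j"
    "\<And>i. i \<in> ?I \<Longrightarrow> (\<Sum>j\<in>?I. F i j) = (1::nat)" "\<And>j. j \<in> ?I \<Longrightarrow> (\<Sum>i\<in>?I. F i j) = (1::nat)" by blast
  \<comment> \<open>Cells of the factor that are supported only by the padding are dropped.\<close>
  define s where "s i j \<longleftrightarrow> i \<in> ?I \<and> j \<in> ?I \<and> F i j > 0 \<and> M i j > 0" for i j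
  have card: "card A \<le> 1" if "A \<subseteq> ?I" "(\<Sum>k\<in>?I. g k) = 1" "\<And>k. k \<in> A \<Longrightarrow> g k > 0" for A and g :: "nat \<Rightarrow> nat"
  proof -
    have "card A = (\<Sum>k\<in>A. 1)" by simp
    also have "\<dots> \<le> (\<Sum>k\<in>A. g k)" using that(3) by (intro sum_mono) (simp add: Suc_leI)
    also have "\<dots> \<le> (\<Sum>k\<in>?I. g k)" using that(1) by (intro sum_mono2) auto
    finally show ?thesis using that by simp
  qed
  have "card {j. s i j} \<le> 1" for i
  proof (cases "i \<in> ?I")
    case True
    show ?thesis by (rule card[OF _ F(2)[OF True]]) (auto simp: s_def)
  next
    case False
    hence "{j. s i j} = {}" by (auto simp: s_def)
    thus ?thesis by simp
  qed
  moreover have "card {i. s i j} \<le> 1" for j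
  proof (cases "j \<in> ?I")
    case True
    show ?thesis by (rule card[OF _ F(3)[OF True]]) (auto simp: s_def)
  next
    case False
    hence "{i. s i j} = {}" by (auto simp: s_def)
    thus ?thesis by simp
  qed
  ultimately have feas: "feasible_schedule n s" by (auto simp: feasible_schedule_def s_def)
  \<comment> \<open>Common to rows and columns: a line of sum \<open>D\<close> has no padding, so
    its factor cell lies in \<open>M\<close> and the sum drops; any other line is below
    \<open>D\<close> from the start.\<close>
  have red: "(\<Sum>k\<in>?I. m k - of_bool (t k)) \<le> D - 1"
    if le: "(\<Sum>k\<in>?I. m k) \<le> D" and z: "(\<Sum>k\<in>?I. z k) = D - (\<Sum>k\<in>?I. m k)" and g: "(\<Sum>k\<in>?I. g k) = 1"
      and gz: "\<And>k. k \<in> ?I \<Longrightarrow> g k \<le> m k + z k" and t: "\<And>k. k \<in> ?I \<Longrightarrow> t k \<longleftrightarrow> g k > 0 \<and> m k > 0"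
    for m z g :: "nat \<Rightarrow> nat" and t
  proof (cases "(\<Sum>k\<in>?I. m k) = D")
    case True
    obtain k where k: "k \<in> ?I" "g k > 0"
      using g by (metis gr0I one_neq_zero sum.neutral)
    have "z k = 0" using z True k by simp
    hence "m k > 0" using gz[OF k(1)] k by simp
    hence "(\<Sum>k\<in>?I. m k - of_bool (t k)) < (\<Sum>k\<in>?I. m k)"
      using k t[OF k(1)] by (intro sum_strict_mono_ex1) (auto intro!: bexI[of _ k])
    thus ?thesis using True by simp
  next
    case False
    have "(\<Sum>k\<in>?I. m k - of_bool (t k)) \<le> (\<Sum>k\<in>?I. m k)" by (intro sum_mono) auto
    thus ?thesis using False le by linarith
  qed
  have "deg_le n (\<lambda>i j. M i j - of_bool (s i j)) (D - 1)"
    unfolding deg_le_def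
  proof (intro conjI ballI)
    fix i assume i: "i \<in> ?I"
    show "(\<Sum>j\<in>?I. M i j - of_bool (s i j)) \<le> D - 1"
    proof (rule red[OF _ _ F(2)[OF i]])
      show "(\<Sum>j\<in>?I. M i j) \<le> D" using r[OF i] by (simp only: r_def)
      show "(\<Sum>j\<in>?I. Z i j) = D - (\<Sum>j\<in>?I. M i j)" using Z(1)[OF i] by (simp only: r_def)
    qed (use i F(1)[OF i] in \<open>auto simp: W_def s_def\<close>)
  next
    fix j assume j: "j \<in> ?I"
    show "(\<Sum>i\<in>?I. M i j - of_bool (s i j)) \<le> D - 1"
    proof (rule red[OF _ _ F(3)[OF j]])
      show "(\<Sum>i\<in>?I. M i j) \<le> D" using c[OF j] by (simp only: c_def)
      show "(\<Sum>i\<in>?I. Z i j) = D - (\<Sum>i\<in>?I. M i j)" using Z(2)[OF j] by (simp only: c_def)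
    qed (use j F(1)[OF _ j] in \<open>auto simp: W_def s_def\<close>)
  qed
  with feas show ?thesis by (intro exI[of _ s]) (auto simp: s_def)
qed

text \<open>One schedule must work for all bounds \<open>D\<close> at once, so that the policy need
  not know the current degree. Maximal cardinality is not what is meant.\<close>

definition max_matching :: "nat \<Rightarrow> queues \<Rightarrow> schedule" where
  "max_matching n M = (SOME s. feasible_schedule n s \<and> (\<forall>i j. s i j \<longrightarrow> 0 < M i j) \<and>
     (\<forall>D. deg_le n M D \<longrightarrow> deg_le n (\<lambda>i j. M i j - of_bool (s i j)) (D - 1)))"

text \<open>A matching that lowers the least valid bound \<open>D0\<close> also works for every
  valid \<open>D\<close>, since \<open>D0 \<le> D\<close>. For \<open>D0 = 0\<close> the empty
  schedule works.\<close>

lemma max_matching: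
  shows feasible_max_matching: "feasible_schedule n (max_matching n M)"
    and max_matching_pos: "max_matching n M i j \<Longrightarrow> 0 < M i j"
    and deg_le_max_matching:
      "deg_le n M D \<Longrightarrow> deg_le n (\<lambda>i j. M i j - of_bool (max_matching n M i j)) (D - 1)"
proof -
  define D0 where "D0 = (LEAST D. deg_le n M D)"
  have D0: "deg_le n M D0"
  proof -
    have "deg_le n M (\<Sum>i=1..n. \<Sum>j=1..n. M i j)"
      unfolding deg_le_def
    proof (intro conjI ballI)
      fix i assume "i \<in> {1..n}"
      thus "(\<Sum>j=1..n. M i j) \<le> (\<Sum>i=1..n. \<Sum>j=1..n. M i j)"
        by (intro member_le_sum) auto
    next
      fix j assume "j \<in> {1..n}"
      thus "(\<Sum>i=1..n. M i j) \<le> (\<Sum>i=1..n. \<Sum>j=1..n. M i j)"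
        by (subst sum.swap, intro member_le_sum[where f = "\<lambda>j. \<Sum>i=1..n. M i j"]) auto
    qed
    thus ?thesis unfolding D0_def by (rule LeastI)
  qed
  have "\<exists>s. feasible_schedule n s \<and> (\<forall>i j. s i j \<longrightarrow> 0 < M i j) \<and>
     (\<forall>D. deg_le n M D \<longrightarrow> deg_le n (\<lambda>i j. M i j - of_bool (s i j)) (D - 1))"
  proof (cases "D0 = 0")
    case True
    thus ?thesis
      using D0 by (intro exI[of _ "\<lambda>_ _. False"]) (auto simp: feasible_schedule_def intro: deg_le_mono)
  next
    case False
    then obtain s where s: "feasible_schedule n s" "\<And>i j. s i j \<Longrightarrow> 0 < M i j"
      "deg_le n (\<lambda>i j. M i j - of_bool (s i j)) (D0 - 1)"
      using matching_reduces_degree[OF D0] by auto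
    have "deg_le n (\<lambda>i j. M i j - of_bool (s i j)) (D - 1)" if "deg_le n M D" for D
      using s(3) Least_le[of "deg_le n M", OF that] by (auto simp: D0_def intro: deg_le_mono)
    thus ?thesis using s by blast
  qed
  from someI_ex[OF this, folded max_matching_def]
  show "feasible_schedule n (max_matching n M)" "max_matching n M i j \<Longrightarrow> 0 < M i j"
    "deg_le n M D \<Longrightarrow> deg_le n (\<lambda>i j. M i j - of_bool (max_matching n M i j)) (D - 1)"
    by blast+
qed

section \<open>The batching policy\<close>

definition is_factor :: "nat \<Rightarrow> nat \<Rightarrow> queues \<Rightarrow> queues \<Rightarrow> bool" where
  "is_factor n \<kappa> M F \<longleftrightarrow> (\<forall>i j. F i j \<le> M i j) \<and>
     (\<forall>i\<in>{1..n}. (\<Sum>j=1..n. F i j) = \<kappa>) \<and> (\<forall>j\<in>{1..n}. (\<Sum>i=1..n. F i j) = \<kappa>)"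

definition has_factor :: "nat \<Rightarrow> nat \<Rightarrow> queues \<Rightarrow> bool" where
  "has_factor n \<kappa> M \<longleftrightarrow> (\<exists>F. is_factor n \<kappa> M F)"

text \<open>With the zero default all packets of a window without a factor count as unmatched, so
  the queue decomposition holds on every sample path.\<close>

definition factor :: "nat \<Rightarrow> nat \<Rightarrow> queues \<Rightarrow> queues" where
  "factor n \<kappa> M = (if has_factor n \<kappa> M then SOME F. is_factor n \<kappa> M F else (\<lambda>_ _. 0))"

lemma is_factor_factor: "has_factor n \<kappa> M \<Longrightarrow> is_factor n \<kappa> M (factor n \<kappa> M)"
  unfolding factor_def has_factor_def by (simp add: someI_ex)

lemma factor_le: "factor n \<kappa> M i j \<le> M i j"
  using is_factor_factor[of n \<kappa> M] by (cases "has_factor n \<kappa> M") (auto simp: is_factor_def factor_def)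

lemma deg_le_factor: "deg_le n (factor n \<kappa> M) \<kappa>"
  using is_factor_factor[of n \<kappa> M]
  by (cases "has_factor n \<kappa> M") (auto simp: is_factor_def factor_def deg_le_def)

definition unserved :: "nat \<Rightarrow> queues \<Rightarrow> queues" where
  "unserved n M = (\<lambda>i j. M i j - of_bool (max_matching n M i j))"

lemma deg_le_unserved: "deg_le n M D \<Longrightarrow> deg_le n (unserved n M) (D - 1)"
  unfolding unserved_def by (rule deg_le_max_matching)

text \<open>The matching uses only nonempty cells of \<open>M\<close>, so the truncated subtraction
  in a queue update can be charged to \<open>M\<close> and leaves the other packets \<open>x\<close>
  of that queue alone.\<close>

lemma unserved_minus:
  "(M i j + x) - (if max_matching n M i j then 1 else 0) = unserved n M i j + (x::nat)"
  using max_matching_pos[of n M i j] by (auto simp: unserved_def)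

lemma sum_deg_le: "deg_le n M D \<Longrightarrow> (\<Sum>i=1..n. \<Sum>j=1..n. M i j) \<le> n * D"
  unfolding deg_le_def using sum_bounded_above[of "{1..n}" "\<lambda>i. \<Sum>j=1..n. M i j" D] by auto

text \<open>Slots are grouped into windows of \<open>d\<close> slots and windows into batches of \<open>B\<close> windows. The first
  \<open>\<kappa>\<close> slots of a window serve a \<open>\<kappa>\<close>-factor of the arrivals of the previous window; the
  remaining \<open>d - \<kappa>\<close> slots serve the pool, to which the packets outside the factors are
  moved only at the end of their batch.\<close>

locale batching =
  fixes n d \<kappa> B :: nat
  assumes d_pos: "d > 0" and \<kappa>_less: "\<kappa> < d" and B_pos: "B > 0"
begin

section \<open>Virtual queues and the policy that serves them\<close>

definition arr :: "arrivals \<Rightarrow> nat \<Rightarrow> queues" where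
  "arr a b i j = (\<Sum>t\<in>{b*d<..b*d+d}. of_bool (a (t, i, j)))"

definition unmatched :: "arrivals \<Rightarrow> nat \<Rightarrow> queues" where
  "unmatched a b i j = arr a b i j - factor n \<kappa> (arr a b) i j"

definition recent :: "arrivals \<Rightarrow> nat \<Rightarrow> queues" where
  "recent a k i j = (\<Sum>t\<in>{k div d * d<..k}. of_bool (a (t, i, j)))"

definition backlog :: "arrivals \<Rightarrow> nat \<Rightarrow> queues" where
  "backlog a k i j = (\<Sum>b\<in>{k div d div B * B..<k div d}. unmatched a b i j)"

text \<open>Index \<open>k\<close> is the state after \<open>k\<close> slots, as in
  \<open>qstate\<close>. Overwriting at a window end loses nothing: by
  \<open>inservice_finished\<close> the old content is then zero on the ports.\<close>

primrec inservice :: "arrivals \<Rightarrow> nat \<Rightarrow> queues" where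
  "inservice a 0 = (\<lambda>i j. 0)"
| "inservice a (Suc k) =
     (if Suc k mod d = 0 then factor n \<kappa> (arr a (k div d))
      else if k mod d < \<kappa> then unserved n (inservice a k) else inservice a k)"

primrec pool :: "arrivals \<Rightarrow> nat \<Rightarrow> queues" where
  "pool a 0 = (\<lambda>i j. 0)"
| "pool a (Suc k) =
     (let p = (if k mod d < \<kappa> then pool a k else unserved n (pool a k))
      in if Suc k mod d = 0 \<and> Suc (k div d) mod B = 0
         then (\<lambda>i j. p i j + (\<Sum>b\<in>{k div d div B * B..<Suc (k div d)}. unmatched a b i j)) else p)"

text \<open>The virtual queues are recomputed from the arrival history: with
  \<open>k = tau - 1\<close> they depend on slots \<open>1..k\<close> only, which
  \<open>truncate_hist\<close> keeps.\<close>

definition batch_policy :: policy where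
  "batch_policy tau h q =
     (let k = tau - 1
      in max_matching n (if k mod d < \<kappa> then inservice h k else pool h k))"

lemma valid_batch_policy: "valid_policy n batch_policy"
  unfolding valid_policy_def batch_policy_def Let_def by (simp add: feasible_max_matching)

section \<open>Window boundaries, causality and the decomposition of the queues\<close>

lemma window_end:
  assumes "Suc k mod d = 0"
  shows "Suc k div d = Suc (k div d)" "k div d * d + d = Suc k" "k mod d = d - 1"
proof -
  show *: "Suc k div d = Suc (k div d)" using assms by (simp add: div_Suc)
  show "k div d * d + d = Suc k" using div_mult_mod_eq[of "Suc k" d] assms * by simp
  show "k mod d = d - 1" using assms d_pos by (simp add: mod_Suc split: if_splits)
qed

lemma not_window_end:
  assumes "Suc k mod d \<noteq> 0"
  shows "Suc k div d = k div d" "Suc k mod d = Suc (k mod d)"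
  using assms by (simp_all add: div_Suc mod_Suc split: if_splits)

lemma arr_cong:
  assumes "\<And>t i j. t \<le> k \<Longrightarrow> a (t, i, j) = a' (t, i, j)" "b * d + d \<le> k"
  shows "arr a b = arr a' b"
  using assms by (auto simp: arr_def fun_eq_iff intro!: sum.cong)

text \<open>Causality: together with \<open>pool_cong\<close> this identifies the virtual queues of
  the truncated history with those of the full path.\<close>

lemma inservice_cong:
  assumes "\<And>t i j. t \<le> k \<Longrightarrow> a (t, i, j) = a' (t, i, j)"
  shows "inservice a k = inservice a' k"
  using assms
proof (induction k)
  case (Suc k)
  have "arr a (k div d) = arr a' (k div d)" if "Suc k mod d = 0"
    using Suc.prems window_end(2)[OF that] by (intro arr_cong[where k = "Suc k"]) auto
  with Suc show ?case by simp
qed simp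

lemma pool_cong:
  assumes "\<And>t i j. t \<le> k \<Longrightarrow> a (t, i, j) = a' (t, i, j)"
  shows "pool a k = pool a' k"
  using assms
proof (induction k)
  case (Suc k)
  have "unmatched a b i j = unmatched a' b i j" if "Suc k mod d = 0" "b < Suc (k div d)" for b i j
  proof -
    have "b * d + d \<le> Suc k"
      using mult_le_mono1[of b "k div d" d] that window_end(2)[OF that(1)] by linarith
    hence "arr a b = arr a' b"
      using Suc.prems by (intro arr_cong[where k = "Suc k"]) auto
    thus ?thesis by (simp add: unmatched_def)
  qed
  moreover have "pool a k = pool a' k" using Suc by simp
  ultimately show ?case by (auto simp: Let_def intro!: ext)
qed simp

lemma deg_le_0_iff: "deg_le n M 0 \<longleftrightarrow> (\<forall>i\<in>{1..n}. \<forall>j\<in>{1..n}. M i j = 0)"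
  by (auto simp: deg_le_def)

text \<open>A factor enters with degree \<open>\<kappa>\<close> and each of the next
  \<open>\<kappa>\<close> slots removes one unit; afterwards the truncated bound is 0.\<close>

lemma deg_le_inservice: "deg_le n (inservice a k) (\<kappa> - k mod d)"
proof (induction k)
  case 0 show ?case by (simp add: deg_le_def)
next
  case (Suc k)
  show ?case
  proof (cases "Suc k mod d = 0")
    case True thus ?thesis by (simp add: deg_le_factor)
  next
    case False
    thus ?thesis using Suc deg_le_unserved[OF Suc] not_window_end[OF False]
      by (auto elim!: deg_le_mono)
  qed
qed

text \<open>The last slot of a window has position \<open>d - 1 \<ge> \<kappa>\<close>, so the old
  factor is completely served before it is replaced.\<close>

lemma inservice_finished:
  assumes "Suc k mod d = 0"
  shows "deg_le n (if k mod d < \<kappa> then unserved n (inservice a k) else inservice a k) 0"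
  using deg_le_inservice[of a k] deg_le_unserved[OF deg_le_inservice[of a k]]
    window_end(3)[OF assms] d_pos \<kappa>_less
  by (auto elim!: deg_le_mono)

text \<open>Each served packet is charged to the virtual queue being scheduled; window and batch
  ends only move packets among the four virtual queues.\<close>

lemma qstate_batch_policy:
  assumes "i \<in> {1..n}" "j \<in> {1..n}"
  shows "qstate batch_policy a k i j = pool a k i j + backlog a k i j + inservice a k i j + recent a k i j"
proof (induction k)
  case 0 show ?case by (simp add: backlog_def recent_def)
next
  case (Suc k)
  let ?h = "truncate_hist (Suc k) a"
  have h: "inservice ?h k = inservice a k" "pool ?h k = pool a k"
    by (intro inservice_cong pool_cong; simp add: truncate_hist_def)+
  define p where "p = (if k mod d < \<kappa> then pool a k else unserved n (pool a k))"
  define s where "s = (if k mod d < \<kappa> then unserved n (inservice a k) else inservice a k)"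
  have "qstate batch_policy a (Suc k) i j =
    p i j + backlog a k i j + s i j + recent a k i j + of_bool (a (Suc k, i, j))"
  proof (cases "k mod d < \<kappa>")
    case True
    thus ?thesis
      using unserved_minus[of "inservice a k" i j "pool a k i j + backlog a k i j + recent a k i j" n]
      by (auto simp: Suc Let_def batch_policy_def h p_def s_def algebra_simps)
  next
    case False
    thus ?thesis
      using unserved_minus[of "pool a k" i j "inservice a k i j + backlog a k i j + recent a k i j" n]
      by (auto simp: Suc Let_def batch_policy_def h p_def s_def algebra_simps)
  qed
  also have "\<dots> = pool a (Suc k) i j + backlog a (Suc k) i j + inservice a (Suc k) i j + recent a (Suc k) i j"
  proof (cases "Suc k mod d = 0")
    case False
    have "{k div d * d<..Suc k} = insert (Suc k) {k div d * d<..k}"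
      by (auto simp: less_Suc_eq_le div_times_less_eq_dividend)
    hence "recent a (Suc k) i j = recent a k i j + of_bool (a (Suc k, i, j))"
      using not_window_end[OF False] by (simp add: recent_def)
    thus ?thesis using False not_window_end[OF False] by (simp add: p_def s_def backlog_def Let_def)
  next
    case True
    note we = window_end[OF True]
    have s0: "s i j = 0"
      using inservice_finished[OF True, of a, folded s_def] assms by (simp add: deg_le_0_iff)
    have "{k div d * d<..Suc k} = insert (Suc k) {k div d * d<..k}"
      by (auto simp: less_Suc_eq_le div_times_less_eq_dividend)
    hence "recent a k i j + of_bool (a (Suc k, i, j)) = arr a (k div d) i j"
      using we by (simp add: arr_def recent_def)
    \<comment> \<open>The closed window splits into the factor, which enters service, and the rest,
      which joins the backlog or, at a batch end, the pool.\<close>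
    also have "\<dots> = factor n \<kappa> (arr a (k div d)) i j + unmatched a (k div d) i j"
      using factor_le[of n \<kappa> "arr a (k div d)" i j] by (simp add: unmatched_def)
    finally have 1: "recent a k i j + of_bool (a (Suc k, i, j)) = \<dots>" .
    have "recent a (Suc k) i j = 0" using True we by (simp add: recent_def)
    have le: "k div d div B * B \<le> k div d" by (rule div_times_less_eq_dividend)
    have 2: "(\<Sum>b\<in>{k div d div B * B..<Suc (k div d)}. unmatched a b i j) =
        backlog a k i j + unmatched a (k div d) i j"
      unfolding backlog_def by (rule sum.atLeastLessThan_Suc[OF le])
    have "pool a (Suc k) i j + backlog a (Suc k) i j =
        p i j + backlog a k i j + unmatched a (k div d) i j"
    proof (cases "Suc (k div d) mod B = 0")
      case True': True
      have "Suc (k div d) div B * B = Suc (k div d)" using True' by auto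
      hence "backlog a (Suc k) i j = 0" using we by (simp add: backlog_def)
      thus ?thesis using True True' 2 by (simp add: p_def Let_def)
    next
      case False
      hence "Suc (k div d) div B = k div d div B" by (simp add: div_Suc split: if_splits)
      hence "backlog a (Suc k) i j = backlog a k i j + unmatched a (k div d) i j"
        using we 2 by (simp add: backlog_def)
      thus ?thesis using True False by (simp add: p_def Let_def)
    qed
    thus ?thesis using 1 s0 True \<open>recent a (Suc k) i j = 0\<close> by simp
  qed
  finally show ?case .
qed

section \<open>Degree of the pool from batch to batch\<close>

definition batch :: "arrivals \<Rightarrow> nat \<Rightarrow> queues" where
  "batch a m i j = (\<Sum>b\<in>{m*B..<m*B+B}. arr a b i j)"

text \<open>The strict bound \<open>B * d - 1\<close> leaves one unit of service to spare in every
  good batch; this is the negative drift of \<open>excess\<close>.\<close>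

definition bad :: "arrivals \<Rightarrow> nat \<Rightarrow> bool" where
  "bad a m \<longleftrightarrow> (\<exists>b\<in>{m*B..<m*B+B}. \<not> has_factor n \<kappa> (arr a b)) \<or> \<not> deg_le n (batch a m) (B * d - 1)"

text \<open>Bounds how far the pool degree at a batch start exceeds \<open>spare\<close>. The
  increment \<open>n * (B * d)\<close> is the crude degree bound of
  \<open>deg_le_batch\<close>.\<close>

primrec excess :: "arrivals \<Rightarrow> nat \<Rightarrow> nat" where
  "excess a 0 = 0"
| "excess a (Suc m) = (if bad a m then excess a m + n * (B * d) else excess a m - 1)"

definition spare :: nat where "spare = B * (d - \<kappa>)"

lemma spare_pos: "spare > 0"
  using \<kappa>_less B_pos by (simp add: spare_def)

lemma arr_le: "arr a b i j \<le> d"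
  using sum_bounded_above[of "{b*d<..b*d+d}" "\<lambda>t. of_bool (a (t, i, j))" "1::nat"]
  by (simp add: arr_def)

lemma unmatched_le: "unmatched a b i j \<le> arr a b i j"
  by (simp add: unmatched_def)

lemma deg_le_batch: "deg_le n (batch a m) (n * (B * d))"
proof -
  have "batch a m i j \<le> B * d" for i j
    using sum_bounded_above[of "{m*B..<m*B+B}" "\<lambda>b. arr a b i j" d] arr_le by (simp add: batch_def)
  thus ?thesis
    using sum_bounded_above[of "{1..n}" "\<lambda>j. batch a m _ j" "B * d"]
      sum_bounded_above[of "{1..n}" "\<lambda>i. batch a m i _" "B * d"]
    by (simp add: deg_le_def)
qed

text \<open>The factors take exactly \<open>B * \<kappa>\<close> out of every row and column sum,
  and \<open>B * d - 1 - B * \<kappa> = spare - 1\<close>.\<close>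

lemma deg_le_unmatched_good:
  assumes "\<not> bad a m"
  shows "deg_le n (\<lambda>i j. \<Sum>b\<in>{m*B..<m*B+B}. unmatched a b i j) (spare - 1)"
proof -
  let ?b = "{m*B..<m*B+B}"
  have fac: "is_factor n \<kappa> (arr a b) (factor n \<kappa> (arr a b))" if "b \<in> ?b" for b
    using assms that is_factor_factor by (auto simp: bad_def)
  have deg: "deg_le n (batch a m) (B * d - 1)" using assms by (simp add: bad_def)
  have eq: "batch a m i j = (\<Sum>b\<in>?b. unmatched a b i j) + (\<Sum>b\<in>?b. factor n \<kappa> (arr a b) i j)" for i j
    by (simp add: batch_def unmatched_def factor_le flip: sum.distrib)
  have "(\<Sum>j=1..n. \<Sum>b\<in>?b. factor n \<kappa> (arr a b) i j) = B * \<kappa>" if "i \<in> {1..n}" for i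
    using fac that by (subst sum.swap) (simp add: is_factor_def)
  moreover have "(\<Sum>i=1..n. \<Sum>b\<in>?b. factor n \<kappa> (arr a b) i j) = B * \<kappa>" if "j \<in> {1..n}" for j
    using fac that by (subst sum.swap) (simp add: is_factor_def)
  ultimately have "\<forall>i\<in>{1..n}. (\<Sum>j=1..n. \<Sum>b\<in>?b. unmatched a b i j) + B * \<kappa> \<le> B * d - 1"
    "\<forall>j\<in>{1..n}. (\<Sum>i=1..n. \<Sum>b\<in>?b. unmatched a b i j) + B * \<kappa> \<le> B * d - 1"
    using deg unfolding deg_le_def by (simp_all add: eq sum.distrib)
  thus ?thesis by (auto simp: deg_le_def spare_def algebra_simps)
qed

text \<open>Only slots at position \<open>\<kappa>\<close> or later in their window serve the pool,
  each lowering the degree by one; \<open>j < B * d\<close> stops short of the next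
  admission.\<close>

lemma deg_le_pool_within:
  assumes "deg_le n (pool a (m * (B * d))) D" "j < B * d"
  shows "deg_le n (pool a (m * (B * d) + j)) (D - (\<Sum>i<j. of_bool (\<kappa> \<le> i mod d)))"
  using assms(2)
proof (induction j)
  case 0 thus ?case using assms by simp
next
  case (Suc j)
  let ?k = "m * (B * d) + j"
  have IH: "deg_le n (pool a ?k) (D - (\<Sum>i<j. of_bool (\<kappa> \<le> i mod d)))" using Suc by simp
  have mod: "?k mod d = j mod d" by (metis mod_mult_self3 mult.assoc)
  \<comment> \<open>A batch end here would make \<open>B * d\<close> divide \<open>Suc j\<close>,
    which is smaller.\<close>
  have "\<not> (Suc ?k mod d = 0 \<and> Suc (?k div d) mod B = 0)"
  proof
    assume *: "Suc ?k mod d = 0 \<and> Suc (?k div d) mod B = 0"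
    then obtain q where q: "Suc (?k div d) = B * q" by auto
    have "Suc ?k = Suc (?k div d) * d" using window_end(2)[of ?k] * by simp
    also note q
    finally have "Suc ?k = (B * d) * q" by (metis mult.assoc mult.commute)
    hence "B * d dvd Suc ?k" by simp
    hence "B * d dvd Suc j" by (metis add_Suc_right dvd_add_right_iff dvd_triv_right)
    thus False using Suc.prems by (auto dest: dvd_imp_le)
  qed
  hence "pool a (Suc ?k) = (if j mod d < \<kappa> then pool a ?k else unserved n (pool a ?k))"
    using mod by (auto simp: Let_def)
  thus ?case using IH deg_le_unserved[OF IH] by auto
qed

lemma spare_slots: "(\<Sum>i<B*d. of_bool (\<kappa> \<le> i mod d)) = spare"
proof -
  have "(\<Sum>i<B*d. of_bool (\<kappa> \<le> i mod d)) = (\<Sum>b<B. \<Sum>i=b*d..<b*d+d. of_bool (\<kappa> \<le> i mod d) :: nat)"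
    by (rule sum.nat_group[symmetric])
  also have "\<dots> = (\<Sum>b<B. \<Sum>i\<in>{0..<d}. of_bool (\<kappa> \<le> i))"
  proof (rule sum.cong[OF refl])
    fix b
    have "(\<Sum>i=b*d..<b*d+d. of_bool (\<kappa> \<le> i mod d) :: nat) =
        (\<Sum>i=0+b*d..<d+b*d. of_bool (\<kappa> \<le> i mod d))"
      by (simp only: add_0 add.commute)
    also have "\<dots> = (\<Sum>i=0..<d. of_bool (\<kappa> \<le> (i + b * d) mod d))"
      by (rule sum.shift_bounds_nat_ivl)
    also have "\<dots> = (\<Sum>i=0..<d. of_bool (\<kappa> \<le> i))"
      by (rule sum.cong) auto
    finally show "(\<Sum>i=b*d..<b*d+d. of_bool (\<kappa> \<le> i mod d)) = (\<Sum>i=0..<d. of_bool (\<kappa> \<le> i) :: nat)" .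
  qed
  also have "(\<Sum>i=0..<d. of_bool (\<kappa> \<le> i)) = d - \<kappa>"
  proof -
    have "{0..<d} \<inter> {i. \<kappa> \<le> i} = {\<kappa>..<d}" by auto
    thus ?thesis by simp
  qed
  finally show ?thesis by (simp add: spare_def)
qed

text \<open>The \<open>spare\<close> pool slots of a batch bring the degree down to
  \<open>excess a m\<close>. Then its unmatched packets add at most \<open>spare - 1\<close> if it
  is good and \<open>n * (B * d)\<close> if it is bad.\<close>

lemma deg_le_pool: "deg_le n (pool a (m * (B * d))) (spare + excess a m)"
proof (induction m)
  case 0 show ?case by (simp add: deg_le_def)
next
  case (Suc m)
  define j where "j = B * d - 1"
  have Bd: "B * d = Suc j" using d_pos B_pos by (simp add: j_def)
  let ?k = "m * (B * d) + j"
  have k: "Suc m * (B * d) = Suc ?k" using Bd by simp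
  let ?D = "\<lambda>j. spare + excess a m - (\<Sum>i<j. of_bool (\<kappa> \<le> i mod d))"
  have *: "deg_le n (pool a ?k) (?D j)"
    using Suc by (rule deg_le_pool_within) (simp add: Bd)
  have mod: "?k mod d = j mod d" by (metis mod_mult_self3 mult.assoc)
  define p where "p = (if ?k mod d < \<kappa> then pool a ?k else unserved n (pool a ?k))"
  have "deg_le n p (?D (Suc j))"
    using * deg_le_unserved[OF *] by (auto simp: mod p_def)
  also have "?D (Suc j) = excess a m" unfolding Bd[symmetric] spare_slots by simp
  finally have p: "deg_le n p (excess a m)" .
  have 1: "Suc ?k mod d = 0" unfolding k[symmetric] by (metis mod_mult_self2_is_0 mult.assoc)
  have w: "Suc (?k div d) = Suc m * B"
    using window_end(1)[OF 1] unfolding k[symmetric] using d_pos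
    by (metis mult.assoc nonzero_mult_div_cancel_right not_gr_zero)
  hence "?k div d = m * B + (B - 1)" using B_pos by simp
  hence 2: "?k div d div B = m" using B_pos by (simp only: div_mult_self3) simp
  let ?u = "\<lambda>i j. \<Sum>b\<in>{m*B..<m*B+B}. unmatched a b i j"
  have "{?k div d div B * B..<Suc (?k div d)} = {m*B..<m*B+B}"
    unfolding 2 w by (simp add: add.commute)
  hence pool: "pool a (Suc m * (B * d)) = (\<lambda>i j. p i j + ?u i j)"
    unfolding k using 1 w by (simp add: p_def Let_def)
  show ?case
  proof (cases "bad a m")
    case False
    show ?thesis unfolding pool
      by (rule deg_le_mono[OF deg_le_add[OF p deg_le_unmatched_good[OF False]]]) (use False spare_pos in auto)
  next
    case True
    have "deg_le n ?u (n * (B * d))"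
      using deg_le_batch[of a m] unfolding batch_def
      by (rule deg_le_mono') (intro sum_mono unmatched_le)
    from deg_le_add[OF p this] show ?thesis unfolding pool
      by (rule deg_le_mono) (use True in auto)
  qed
qed

text \<open>An exact identity over the reals, so that expectations can be taken term by term
  although the indicator enters with a minus sign.\<close>

lemma sum_unmatched:
  "real (\<Sum>i=1..n. \<Sum>j=1..n. unmatched a b i j) =
     real (\<Sum>i=1..n. \<Sum>j=1..n. arr a b i j) - real (n * \<kappa>) * of_bool (has_factor n \<kappa> (arr a b))"
proof -
  have "(\<Sum>i=1..n. \<Sum>j=1..n. arr a b i j) =
    (\<Sum>i=1..n. \<Sum>j=1..n. unmatched a b i j) + (\<Sum>i=1..n. \<Sum>j=1..n. factor n \<kappa> (arr a b) i j)"
    by (simp add: unmatched_def factor_le flip: sum.distrib)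
  moreover have "(\<Sum>i=1..n. \<Sum>j=1..n. factor n \<kappa> (arr a b) i j) = n * \<kappa> * of_bool (has_factor n \<kappa> (arr a b))"
  proof (cases "has_factor n \<kappa> (arr a b)")
    case True
    thus ?thesis using is_factor_factor[OF True] by (simp add: is_factor_def)
  next
    case False
    thus ?thesis by (simp add: factor_def)
  qed
  ultimately show ?thesis by simp
qed

text \<open>Pool and factor in service are bounded through their degrees; backlog and current window
  stay random and are estimated only in expectation.\<close>

lemma total_queue_le:
  "real (\<Sum>i=1..n. \<Sum>j=1..n. qstate batch_policy a k i j) \<le>
     real n * (spare + excess a (k div (B * d))) + real n * d
     + (\<Sum>b\<in>{k div d div B * B..<k div d}.
         real (\<Sum>i=1..n. \<Sum>j=1..n. arr a b i j) - real (n * \<kappa>) * of_bool (has_factor n \<kappa> (arr a b)))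
     + real (\<Sum>i=1..n. \<Sum>j=1..n. recent a k i j)"
proof -
  let ?\<Sigma> = "\<lambda>M. \<Sum>i=1..n. \<Sum>j=1..n. M i j :: nat"
  define m where "m = k div (B * d)"
  have "k = m * (B * d) + k mod (B * d)" unfolding m_def by (rule div_mult_mod_eq[symmetric])
  hence "deg_le n (pool a k) (spare + excess a m)"
    using deg_le_pool_within[OF deg_le_pool, of "k mod (B * d)" a m] d_pos B_pos
    by (auto elim: deg_le_mono)
  hence 1: "?\<Sigma> (pool a k) \<le> n * (spare + excess a m)" by (rule sum_deg_le)
  have 2: "?\<Sigma> (inservice a k) \<le> n * d"
    using deg_le_inservice[of a k] \<kappa>_less by (intro sum_deg_le) (auto elim: deg_le_mono)
  have "?\<Sigma> (backlog a k) = (\<Sum>i=1..n. \<Sum>b\<in>{k div d div B * B..<k div d}. \<Sum>j=1..n. unmatched a b i j)"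
    unfolding backlog_def by (intro sum.cong refl sum.swap)
  also have "\<dots> = (\<Sum>b\<in>{k div d div B * B..<k div d}. ?\<Sigma> (unmatched a b))"
    by (rule sum.swap)
  finally have "?\<Sigma> (backlog a k) = (\<Sum>b\<in>{k div d div B * B..<k div d}. ?\<Sigma> (unmatched a b))" .
  hence 3: "real (?\<Sigma> (backlog a k)) = (\<Sum>b\<in>{k div d div B * B..<k div d}.
      real (?\<Sigma> (arr a b)) - real (n * \<kappa>) * of_bool (has_factor n \<kappa> (arr a b)))"
    by (simp only: of_nat_sum[of _ "{k div d div B * B..<k div d}"] sum_unmatched)
  have "?\<Sigma> (qstate batch_policy a k) =
      ?\<Sigma> (pool a k) + ?\<Sigma> (backlog a k) + ?\<Sigma> (inservice a k) + ?\<Sigma> (recent a k)"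
    by (simp add: qstate_batch_policy sum.distrib)
  hence "real (?\<Sigma> (qstate batch_policy a k)) \<le>
    real (n * (spare + excess a m)) + real (?\<Sigma> (backlog a k)) + real (n * d) + real (?\<Sigma> (recent a k))"
    using 1 2 by linarith
  thus ?thesis unfolding 3 m_def by simp
qed

end

section \<open>Bernoulli product measures\<close>

abbreviation bernoulli_field :: "'a set \<Rightarrow> real \<Rightarrow> ('a \<Rightarrow> bool) pmf" where
  "bernoulli_field I q \<equiv> Pi_pmf I False (\<lambda>_. bernoulli_pmf q)"

lemma finite_set_bernoulli_field: "finite I \<Longrightarrow> finite (set_pmf (bernoulli_field I q))"
  by (simp add: set_Pi_pmf finite_PiE_dflt)

lemma integrable_bernoulli_field [simp]:
  fixes f :: "_ \<Rightarrow> real"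
  shows "finite I \<Longrightarrow> integrable (bernoulli_field I q) f"
  by (intro integrable_measure_pmf_finite finite_set_bernoulli_field)

lemma expectation_bernoulli_field_mono:
  fixes f g :: "_ \<Rightarrow> real"
  assumes "finite I" "\<And>a. f a \<le> g a"
  shows "measure_pmf.expectation (bernoulli_field I q) f \<le> measure_pmf.expectation (bernoulli_field I q) g"
  using assms by (intro integral_mono) auto

lemma expectation_pair_pmf_mult:
  fixes f g :: "_ \<Rightarrow> real"
  assumes fin: "finite (set_pmf M)" "finite (set_pmf N)"
  shows "measure_pmf.expectation (pair_pmf M N) (\<lambda>z. f (fst z) * g (snd z)) =
    measure_pmf.expectation M f * measure_pmf.expectation N g"
proof -
  have "measure_pmf.expectation (pair_pmf M N) (\<lambda>z. f (fst z) * g (snd z)) =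
    (\<Sum>(x,y)\<in>set_pmf M \<times> set_pmf N. (pmf M x * f x) * (pmf N y * g y))"
    using fin by (subst integral_measure_pmf[of "set_pmf M \<times> set_pmf N"])
      (auto simp: pmf_pair intro!: sum.cong)
  also have "\<dots> = (\<Sum>x\<in>set_pmf M. pmf M x * f x) * (\<Sum>y\<in>set_pmf N. pmf N y * g y)"
    by (simp add: sum.cartesian_product sum_product)
  also have "\<dots> = measure_pmf.expectation M f * measure_pmf.expectation N g"
    using integral_measure_pmf[OF fin(1), of M f] integral_measure_pmf[OF fin(2), of N g] by simp
  finally show ?thesis .
qed

text \<open>The field on \<open>I\<close> is an independent pair of fields on \<open>A\<close> and
  \<open>I - A\<close>; \<open>f\<close> reads only the first and \<open>g\<close> only the
  second.\<close>

lemma expectation_bernoulli_field_mult: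
  fixes f g :: "_ \<Rightarrow> real"
  assumes fin: "finite I" and A: "A \<subseteq> I"
    and f: "\<And>a a'. (\<And>x. x \<in> A \<Longrightarrow> a x = a' x) \<Longrightarrow> f a = f a'"
    and g: "\<And>a a'. (\<And>x. x \<in> I - A \<Longrightarrow> a x = a' x) \<Longrightarrow> g a = g a'"
  shows "measure_pmf.expectation (bernoulli_field I q) (\<lambda>a. f a * g a) =
    measure_pmf.expectation (bernoulli_field I q) f * measure_pmf.expectation (bernoulli_field I q) g"
proof -
  let ?E = "measure_pmf.expectation"
  let ?P = "bernoulli_field A q" and ?R = "bernoulli_field (I - A) q"
  have finA: "finite A" using fin A finite_subset by blast
  have fin': "finite (set_pmf ?P)" "finite (set_pmf ?R)"
    using fin finA by (auto intro: finite_set_bernoulli_field)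
  have I: "bernoulli_field I q = map_pmf (\<lambda>(u,v) x. if x \<in> A then u x else v x) (pair_pmf ?P ?R)"
    using Pi_pmf_union[of A "I - A" False "\<lambda>_. bernoulli_pmf q"] fin finA A by (simp add: Un_absorb1)
  have *: "f (\<lambda>x. if x \<in> A then u x else v x) = f u" "g (\<lambda>x. if x \<in> A then u x else v x) = g v" for u v
    by (auto intro: f g)
  have "?E (bernoulli_field I q) (\<lambda>a. f a * g a) = ?E (pair_pmf ?P ?R) (\<lambda>z. f (fst z) * g (snd z))"
    unfolding I by (simp add: * split_beta)
  also have "\<dots> = ?E ?P f * ?E ?R g" by (rule expectation_pair_pmf_mult[OF fin'])
  also have "?E ?P f = ?E (bernoulli_field I q) f"
    unfolding I by (simp add: * split_beta)
  also have "?E ?R g = ?E (bernoulli_field I q) g"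
    unfolding I by (simp add: * split_beta)
  finally show ?thesis .
qed

section \<open>Mean, exponential moment and Chernoff bound of a count\<close>

lemma expectation_count:
  assumes "finite I" "Z \<subseteq> I" "0 \<le> q" "q \<le> 1"
  shows "measure_pmf.expectation (bernoulli_field I q) (\<lambda>a. \<Sum>z\<in>Z. of_bool (a z)) = q * card Z"
proof -
  have "measure_pmf.expectation (bernoulli_field I q) (\<lambda>a. of_bool (a z) :: real) = q" if "z \<in> Z" for z
  proof -
    have "measure_pmf.expectation (bernoulli_field I q) (\<lambda>a. of_bool (a z) :: real) =
        measure_pmf.expectation (map_pmf (\<lambda>a. a z) (bernoulli_field I q)) of_bool"
      by simp
    also have "\<dots> = q" using assms that by (subst Pi_pmf_component) auto
    finally show ?thesis .
  qed
  thus ?thesis using assms by (subst Bochner_Integration.integral_sum) (auto simp: mult.commute)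
qed

text \<open>By independence the moment generating function is a power of
  \<open>1 + q * (exp s - 1)\<close>. Both signs of \<open>s\<close> are allowed.\<close>

lemma expectation_exp_count:
  assumes "finite I" "Z \<subseteq> I" "0 \<le> q" "q \<le> 1"
  shows "measure_pmf.expectation (bernoulli_field I q) (\<lambda>a. exp (s * (\<Sum>z\<in>Z. of_bool (a z))))
    \<le> exp (q * card Z * (exp s - 1))"
proof -
  have Z: "finite Z" using assms finite_subset by blast
  let ?f = "\<lambda>z v. if z \<in> Z then exp (s * of_bool v) else 1 :: real"
  have "exp (s * (\<Sum>z\<in>Z. of_bool (a z))) = (\<Prod>z\<in>I. ?f z (a z))" for a
  proof -
    have "exp (s * (\<Sum>z\<in>Z. of_bool (a z))) = (\<Prod>z\<in>Z. exp (s * of_bool (a z)))"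
      unfolding sum_distrib_left using Z by (rule exp_sum)
    also have "\<dots> = (\<Prod>z\<in>I. ?f z (a z))"
      using assms by (intro prod.mono_neutral_cong_left) auto
    finally show ?thesis .
  qed
  hence "measure_pmf.expectation (bernoulli_field I q) (\<lambda>a. exp (s * (\<Sum>z\<in>Z. of_bool (a z)))) =
    (\<Prod>z\<in>I. measure_pmf.expectation (bernoulli_pmf q) (?f z))"
    using assms by (simp only:) (subst expectation_prod_Pi_pmf, auto intro: integrable_measure_pmf_finite)
  also have "\<dots> = (\<Prod>z\<in>I. if z \<in> Z then 1 + q * (exp s - 1) else 1)"
    using assms by (intro prod.cong) (auto simp: algebra_simps)
  also have "\<dots> = (1 + q * (exp s - 1)) ^ card Z"
    using assms by (simp add: prod.If_cases Int_absorb1)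
  also have "\<dots> \<le> exp (q * (exp s - 1)) ^ card Z"
  proof (rule power_mono[OF exp_ge_add_one_self])
    have "0 \<le> (1 - q) + q * exp s" using assms by (intro add_nonneg_nonneg) auto
    thus "0 \<le> 1 + q * (exp s - 1)" by (simp add: algebra_simps)
  qed
  also have "\<dots> = exp (q * card Z * (exp s - 1))"
    by (simp add: mult_ac flip: exp_of_nat_mult)
  finally show ?thesis .
qed

text \<open>Markov's inequality for the exponential moment. The factor \<open>s\<close> in the
  hypothesis covers the upper tail for \<open>s > 0\<close> and the lower tail for
  \<open>s < 0\<close>.\<close>

lemma chernoff_count:
  assumes "finite I" "Z \<subseteq> I" "0 \<le> q" "q \<le> 1"
    and "\<And>a. P a \<Longrightarrow> s * c \<le> s * (\<Sum>z\<in>Z. of_bool (a z))"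
  shows "measure_pmf.expectation (bernoulli_field I q) (\<lambda>a. of_bool (P a))
    \<le> exp (q * card Z * (exp s - 1) - s * c)"
proof -
  have "measure_pmf.expectation (bernoulli_field I q) (\<lambda>a. of_bool (P a)) \<le>
    measure_pmf.expectation (bernoulli_field I q) (\<lambda>a. exp (s * (\<Sum>z\<in>Z. of_bool (a z))) * exp (- s * c))"
    using assms by (intro expectation_bernoulli_field_mono) (auto simp flip: exp_add)
  also have "\<dots> = measure_pmf.expectation (bernoulli_field I q) (\<lambda>a. exp (s * (\<Sum>z\<in>Z. of_bool (a z)))) * exp (- s * c)"
    by simp
  also have "\<dots> \<le> exp (q * card Z * (exp s - 1)) * exp (- s * c)"
    using assms by (intro mult_right_mono expectation_exp_count) auto
  also have "\<dots> = exp (q * card Z * (exp s - 1) - s * c)" by (simp flip: exp_add)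
  finally show ?thesis .
qed

lemma expectation_union_bound:
  assumes "finite I" "finite S" "\<And>a. P a \<Longrightarrow> \<exists>x\<in>S. R x a"
  shows "measure_pmf.expectation (bernoulli_field I q) (\<lambda>a. of_bool (P a)) \<le>
    (\<Sum>x\<in>S. measure_pmf.expectation (bernoulli_field I q) (\<lambda>a. of_bool (R x a) :: real))"
proof -
  have "of_bool (P a) \<le> (\<Sum>x\<in>S. of_bool (R x a) :: real)" for a
  proof (cases "P a")
    case True
    with assms(3) obtain x where x: "x \<in> S" "R x a" by blast
    hence "(of_bool (R x a) :: real) \<le> (\<Sum>x\<in>S. of_bool (R x a))"
      using assms(2) by (intro member_le_sum) auto
    thus ?thesis using x True by simp
  qed (simp add: sum_nonneg)
  hence "measure_pmf.expectation (bernoulli_field I q) (\<lambda>a. of_bool (P a)) \<le>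
    measure_pmf.expectation (bernoulli_field I q) (\<lambda>a. \<Sum>x\<in>S. of_bool (R x a) :: real)"
    using assms by (intro expectation_bernoulli_field_mono) auto
  also have "\<dots> = (\<Sum>x\<in>S. measure_pmf.expectation (bernoulli_field I q) (\<lambda>a. of_bool (R x a)))"
    using assms by (intro Bochner_Integration.integral_sum) auto
  finally show ?thesis .
qed

lemma exp_minus_le: "exp (- x) \<le> 1 - x + x ^ 2" if "x \<ge> 0" for x :: real
proof -
  have "exp (- x) = 1 / exp x" by (simp add: exp_minus inverse_eq_divide)
  also have "\<dots> \<le> 1 / (1 + x)" using that by (intro divide_left_mono) auto
  also have "\<dots> \<le> 1 - x + x ^ 2"
  proof -
    have "(1 - x + x ^ 2) * (1 + x) = 1 + x ^ 3" by (simp add: algebra_simps power2_eq_square power3_eq_cube)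
    hence "1 \<le> (1 - x + x ^ 2) * (1 + x)" using that by simp
    thus ?thesis using that by (simp add: divide_simps)
  qed
  finally show ?thesis .
qed

section \<open>Summing a union bound over pairs of port sets\<close>

lemma sum_power_card_Pow:
  fixes u :: real
  assumes "finite A"
  shows "(\<Sum>X\<in>Pow A. u ^ card X) = (1 + u) ^ card A"
    and "(\<Sum>X\<in>Pow A. u ^ card (A - X)) = (1 + u) ^ card A"
  using prod_add[OF assms, of "\<lambda>_. u" "\<lambda>_. 1"] prod_add[OF assms, of "\<lambda>_. 1" "\<lambda>_. u"]
  by (simp_all add: add.commute)

text \<open>With \<open>s = (1 + u) ^ card A\<close> the sum factors as \<open>s * (s - 1)\<close>.
  Excluding the empty \<open>Y\<close> yields the small factor \<open>s - 1\<close>, which is at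
  most \<open>2 * (card A * u)\<close>.\<close>

lemma sum_pair_cards_le:
  fixes u :: real
  assumes A: "finite A" and u: "u \<ge> 0" "card A * u \<le> 1"
  shows "(\<Sum>(X,Y)\<in>Pow A \<times> Pow A. of_bool (Y \<noteq> {}) * u ^ card Y * u ^ card (A - X)) \<le> 6 * (card A * u)"
proof -
  define s where "s = (1 + u) ^ card A"
  have "s \<le> exp u ^ card A" unfolding s_def using u by (intro power_mono) auto
  also have "\<dots> = exp (card A * u)" by (simp add: exp_of_nat_mult)
  finally have s: "s \<le> exp (card A * u)" .
  also have "\<dots> \<le> 1 + card A * u + (card A * u)\<^sup>2" using u by (intro exp_bound) auto
  also have "(card A * u)\<^sup>2 \<le> card A * u"
    using u mult_left_le_one_le[of "card A * u" "card A * u"] by (simp add: power2_eq_square)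
  finally have s1: "s - 1 \<le> 2 * (card A * u)" by linarith
  have "exp (card A * u) \<le> exp 1" using u by simp
  also have "\<dots> \<le> 3" by (rule exp_le)
  finally have s3: "s \<le> 3" using s by linarith
  have s0: "s \<ge> 1" using u by (simp add: s_def)
  have "(\<Sum>Y\<in>Pow A. of_bool (Y \<noteq> {}) * u ^ card Y) = (\<Sum>Y\<in>Pow A. u ^ card Y - of_bool (Y = {}))"
    by (intro sum.cong) auto
  also have "\<dots> = s - 1"
    using A by (simp add: sum_subtractf sum_power_card_Pow s_def of_bool_def sum.delta)
  finally have *: "(\<Sum>Y\<in>Pow A. of_bool (Y \<noteq> {}) * u ^ card Y) = s - 1" .
  have "(\<Sum>(X,Y)\<in>Pow A \<times> Pow A. of_bool (Y \<noteq> {}) * u ^ card Y * u ^ card (A - X)) =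
    (\<Sum>X\<in>Pow A. u ^ card (A - X)) * (\<Sum>Y\<in>Pow A. of_bool (Y \<noteq> {}) * u ^ card Y)"
    by (simp add: sum_product sum.cartesian_product mult_ac)
  also have "\<dots> = s * (s - 1)" unfolding * using A by (simp add: sum_power_card_Pow s_def)
  also have "\<dots> \<le> 3 * (2 * (card A * u))" using s0 s1 s3 u by (intro mult_mono) auto
  finally show ?thesis by simp
qed

section \<open>Failure probabilities and the expected queue size\<close>

text \<open>\<open>is_factor\<close> asks for \<open>F i j \<le> M i j\<close> at all indices, the
  margin lemma only controls the ports; cutting \<open>F\<close> off to 0 elsewhere bridges the
  gap.\<close>

lemma has_factor_iff:
  "has_factor n \<kappa> M \<longleftrightarrow> (\<exists>F. (\<forall>i\<in>{1..n}. \<forall>j\<in>{1..n}. F i j \<le> M i j) \<and>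
     (\<forall>i\<in>{1..n}. (\<Sum>j=1..n. F i j) = \<kappa>) \<and> (\<forall>j\<in>{1..n}. (\<Sum>i=1..n. F i j) = \<kappa>))"
  (is "_ \<longleftrightarrow> (\<exists>F. ?P F)")
proof
  assume "has_factor n \<kappa> M"
  thus "\<exists>F. ?P F" unfolding has_factor_def is_factor_def by blast
next
  assume "\<exists>F. ?P F"
  then obtain F where F: "?P F" ..
  have "is_factor n \<kappa> M (\<lambda>i j. if i \<in> {1..n} \<and> j \<in> {1..n} then F i j else 0)"
    using F by (simp add: is_factor_def)
  thus "has_factor n \<kappa> M" unfolding has_factor_def by blast
qed

lemma has_factor_cong:
  assumes "\<And>i j. i \<in> {1..n} \<Longrightarrow> j \<in> {1..n} \<Longrightarrow> M i j = M' i j"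
  shows "has_factor n \<kappa> M \<longleftrightarrow> has_factor n \<kappa> M'"
  unfolding has_factor_iff using assms by simp

lemma deg_le_cong:
  assumes "\<And>i j. i \<in> {1..n} \<Longrightarrow> j \<in> {1..n} \<Longrightarrow> M i j = M' i j"
  shows "deg_le n M D \<longleftrightarrow> deg_le n M' D"
  unfolding deg_le_def using assms by simp

text \<open>Contrapositive of \<open>bounded_matrix_with_margins\<close> with all margins
  \<open>\<kappa>\<close>; the violated cut is what the union bound runs over.\<close>

lemma no_factor_cut:
  assumes "\<not> has_factor n \<kappa> M"
  shows "\<exists>X\<in>Pow {1..n}. \<exists>Y\<in>Pow {1..n}. (\<Sum>i\<in>X. \<Sum>j\<in>Y. M i j) + \<kappa> * card ({1..n} - Y) < \<kappa> * card X"
proof (rule ccontr)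
  assume *: "\<not> ?thesis"
  have "has_factor n \<kappa> M"
    unfolding has_factor_iff
  proof (rule bounded_matrix_with_margins)
    fix X Y assume "X \<subseteq> {1..n}" "Y \<subseteq> {1..n}"
    with * show "(\<Sum>i\<in>X. \<kappa>) \<le> (\<Sum>i\<in>X. \<Sum>j\<in>Y. M i j) + (\<Sum>j\<in>{1..n} - Y. \<kappa>)"
      by (force simp: not_less mult.commute)
  qed auto
  with assms show False by contradiction
qed

text \<open>\<open>\<eta>\<close> is a gap between the mean load \<open>\<rho> * d\<close> of a port
  in a window and the degree of the factor. It is asked for only if \<open>\<kappa> > 0\<close>,
  since the zero matrix is always a 0-factor.\<close>

locale loaded_switch = batching +
  fixes \<rho> \<eta> :: real
  assumes n_pos: "n > 0" and \<rho>: "0 < \<rho>" "\<rho> < 1" and \<eta>: "\<eta> \<ge> 0"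
    and \<kappa>_\<eta>: "\<kappa> > 0 \<Longrightarrow> \<kappa> + \<eta> \<le> \<rho> * d"
begin

abbreviation ports :: "nat set" where "ports \<equiv> {1..n}"

abbreviation slots :: "nat \<Rightarrow> (nat \<times> nat \<times> nat) set" where
  "slots k \<equiv> {1..<Suc k} \<times> ports \<times> ports"

abbreviation expect :: "nat \<Rightarrow> (arrivals \<Rightarrow> real) \<Rightarrow> real" where
  "expect k f \<equiv> measure_pmf.expectation (bernoulli_field (slots k) (\<rho> / n)) f"

lemma rate: "0 \<le> \<rho> / n" "\<rho> / n \<le> 1"
  using \<rho> n_pos by (auto simp: divide_simps)

lemma expect_mono: "(\<And>a. f a \<le> g a) \<Longrightarrow> expect k f \<le> expect k g"
  by (intro expectation_bernoulli_field_mono) auto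

section \<open>Probability that a window has no factor\<close>

lemma sum_arr:
  "real (\<Sum>i\<in>X. \<Sum>j\<in>Y. arr a b i j) = (\<Sum>z\<in>{b*d<..b*d+d} \<times> X \<times> Y. of_bool (a z))"
proof -
  have "(\<Sum>i\<in>X. \<Sum>j\<in>Y. arr a b i j) = (\<Sum>i\<in>X. \<Sum>t\<in>{b*d<..b*d+d}. \<Sum>j\<in>Y. of_bool (a (t, i, j)))"
    unfolding arr_def by (intro sum.cong refl sum.swap)
  also have "\<dots> = (\<Sum>t\<in>{b*d<..b*d+d}. \<Sum>i\<in>X. \<Sum>j\<in>Y. of_bool (a (t, i, j)))"
    by (rule sum.swap)
  finally have *: "(\<Sum>i\<in>X. \<Sum>j\<in>Y. arr a b i j) = \<dots>" .
  show ?thesis unfolding * by (simp add: sum.cartesian_product split_beta del: sum_of_bool_eq)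
qed

text \<open>The price per port in the union bound: a cut with side sizes \<open>x\<close> and
  \<open>y\<close> fails with probability at most the \<open>2 * min x y\<close>-th power of this
  number.\<close>

definition no_factor_base :: real where "no_factor_base = exp (- (\<eta>\<^sup>2 / (16 * d)))"

text \<open>Since \<open>(n - x) * (n - y) \<ge> 0\<close>, the excess \<open>x + y - n\<close> is
  at most \<open>x * y / n\<close>; the failing cut becomes comparable with a mean proportional to
  \<open>x * y / n\<close>.\<close>

lemma cut_count_le:
  fixes x y m :: nat
  assumes "e + m * (n - y) < m * x" "x \<le> n" "y \<le> n"
  shows "real e \<le> m * x * y / n"
proof -
  have "real e + m * (real n - y) \<le> m * x"
    using assms by (metis less_imp_le of_nat_add of_nat_diff of_nat_le_iff of_nat_mult)
  moreover have "0 \<le> m * ((real n - x) * (real n - y))" using assms by simp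
  ultimately have "real e * n \<le> m * x * y" 
  proof -
    assume 1: "real e + m * (real n - y) \<le> m * x" and 2: "0 \<le> m * ((real n - x) * (real n - y))"
    from 1 have "real n * (real e + m * (real n - y)) \<le> real n * (m * x)"
      by (intro mult_left_mono) auto
    with 2 show ?thesis by (simp add: algebra_simps)
  qed
  thus ?thesis using n_pos by (simp add: divide_simps)
qed

text \<open>The count has mean \<open>\<rho> * d * x * y / n\<close>, and failure forces it down to
  \<open>\<kappa> * x * y / n\<close>, a shortfall of at least \<open>\<eta> * x * y / n\<close>.
  The two symmetric terms of the bound correspond to which of \<open>X\<close> and \<open>Y\<close>
  is smaller.\<close>

lemma prob_cut:
  assumes XY: "X \<subseteq> ports" "Y \<subseteq> ports" and bk: "b * d + d \<le> k"
  defines "u \<equiv> no_factor_base"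
  shows "expect k (\<lambda>a. of_bool ((\<Sum>i\<in>X. \<Sum>j\<in>Y. arr a b i j) + \<kappa> * card (ports - Y) < \<kappa> * card X))
     \<le> of_bool (Y \<noteq> {}) * u ^ card Y * u ^ card (ports - X) + of_bool (X \<noteq> {}) * u ^ card X * u ^ card (ports - Y)"
proof -
  define x y where "x = card X" and "y = card Y"
  have fin: "finite X" "finite Y" using XY finite_subset by blast+
  have xy: "x \<le> n" "y \<le> n"
    using card_mono[OF _ XY(1)] card_mono[OF _ XY(2)] by (auto simp: x_def y_def)
  have card: "card (ports - Y) = n - y" "card (ports - X) = n - x"
    using XY fin by (simp_all add: card_Diff_subset x_def y_def)
  have u: "0 \<le> u" "u \<le> 1" by (simp_all add: u_def no_factor_base_def)
  show ?thesis
  proof (cases "\<kappa> > 0 \<and> n - y < x")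
    case False
    hence "\<not> (e + \<kappa> * (n - y) < \<kappa> * x)" for e
      by (metis add_lessD1 add.commute nat_mult_less_cancel_disj)
    hence "(\<lambda>a. of_bool ((\<Sum>i\<in>X. \<Sum>j\<in>Y. arr a b i j) + \<kappa> * card (ports - Y) < \<kappa> * card X)) = (\<lambda>a. 0::real)"
      unfolding card x_def[symmetric] by simp
    thus ?thesis using u by simp
  next
    case True
    hence x0: "x > 0" and y0: "y > 0" using xy by auto
    hence ne: "X \<noteq> {}" "Y \<noteq> {}" by (auto simp: x_def y_def)
    define Z where "Z = {b*d<..b*d+d} \<times> X \<times> Y"
    \<comment> \<open>This choice minimises the exponent
      \<open>- \<theta> * \<eta> + d * \<theta>\<^sup>2\<close>.\<close>
    define \<theta> where "\<theta> = \<eta> / (2 * d)"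
    define t where "t = real x * real y / n"
    have \<theta>: "\<theta> \<ge> 0" using \<eta> by (simp add: \<theta>_def)
    have "expect k (\<lambda>a. of_bool ((\<Sum>i\<in>X. \<Sum>j\<in>Y. arr a b i j) + \<kappa> * card (ports - Y) < \<kappa> * card X))
      \<le> exp (\<rho> / n * card Z * (exp (- \<theta>) - 1) - (- \<theta>) * (\<kappa> * x * y / n))"
    proof (rule chernoff_count)
      show "Z \<subseteq> slots k" using bk XY by (auto simp: Z_def)
      fix a assume "(\<Sum>i\<in>X. \<Sum>j\<in>Y. arr a b i j) + \<kappa> * card (ports - Y) < \<kappa> * card X"
      hence "real (\<Sum>i\<in>X. \<Sum>j\<in>Y. arr a b i j) \<le> \<kappa> * x * y / n"
        unfolding card using xy by (intro cut_count_le) (auto simp: x_def)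
      hence "(\<Sum>z\<in>Z. of_bool (a z)) \<le> \<kappa> * x * y / n"
        unfolding sum_arr Z_def .
      thus "- \<theta> * (\<kappa> * x * y / n) \<le> - \<theta> * (\<Sum>z\<in>Z. of_bool (a z))"
        using \<theta> by (intro mult_left_mono_neg) auto
    qed (use rate in auto)
    also have "\<rho> / n * card Z * (exp (- \<theta>) - 1) - (- \<theta>) * (\<kappa> * x * y / n) =
        t * (\<rho> * d * (exp (- \<theta>) - 1) + \<theta> * \<kappa>)"
      by (simp add: Z_def t_def x_def y_def card_cartesian_product algebra_simps
          add_divide_distrib diff_divide_distrib)
    also have "\<dots> \<le> t * (- (\<eta>\<^sup>2 / (4 * d)))"
    proof (rule mult_left_mono)
      have "\<rho> * d * (exp (- \<theta>) - 1) \<le> \<rho> * d * (- \<theta> + \<theta>\<^sup>2)"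
        using exp_minus_le[OF \<theta>] \<rho> by (intro mult_left_mono) auto
      also have "\<dots> = - \<theta> * (\<rho> * d) + \<rho> * (d * \<theta>\<^sup>2)" by (simp add: algebra_simps)
      also have "\<rho> * (d * \<theta>\<^sup>2) \<le> 1 * (d * \<theta>\<^sup>2)" using \<rho> by (intro mult_right_mono) auto
      finally have "\<rho> * d * (exp (- \<theta>) - 1) + \<theta> * \<kappa> \<le> \<theta> * (\<kappa> - \<rho> * d) + d * \<theta>\<^sup>2"
        by (simp add: algebra_simps)
      also have "\<theta> * (\<kappa> - \<rho> * d) \<le> \<theta> * (- \<eta>)" using \<theta> \<kappa>_\<eta> True by (intro mult_left_mono) auto
      also have "\<theta> * (- \<eta>) + d * \<theta>\<^sup>2 = - (\<eta>\<^sup>2 / (4 * d))"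
        using d_pos by (simp add: \<theta>_def field_simps power2_eq_square)
      finally show "\<rho> * d * (exp (- \<theta>) - 1) + \<theta> * \<kappa> \<le> - (\<eta>\<^sup>2 / (4 * d))" by simp
    qed (simp add: t_def)
    also have "\<dots> \<le> real (min x y) / 2 * (- (\<eta>\<^sup>2 / (4 * d)))"
    proof (rule mult_right_mono_neg)
      \<comment> \<open>A cut can fail only if \<open>x + y > n\<close>, so the larger side exceeds
        \<open>n / 2\<close>.\<close>
      have "real (min x y) * n \<le> real (min x y) * (2 * real (max x y))"
        using True by (intro mult_left_mono) auto
      also have "\<dots> = 2 * (real x * real y)" by (auto simp: min_def max_def)
      finally show "real (min x y) / 2 \<le> t" using n_pos by (simp add: t_def field_simps)
    qed simp
    also have "real (min x y) / 2 * (- (\<eta>\<^sup>2 / (4 * d))) = real (2 * min x y) * (- (\<eta>\<^sup>2 / (16 * d)))"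
      by simp
    also have "exp \<dots> = u ^ (2 * min x y)"
      by (simp only: u_def no_factor_base_def exp_of_nat_mult)
    finally have le: "expect k (\<lambda>a. of_bool ((\<Sum>i\<in>X. \<Sum>j\<in>Y. arr a b i j) + \<kappa> * card (ports - Y) < \<kappa> * card X))
      \<le> u ^ (2 * min x y)" by simp
    show ?thesis
    proof (cases "y \<le> x")
      case True': True
      \<comment> \<open>From \<open>x + y > n\<close> it follows that \<open>n - x < y\<close>,
        hence \<open>y + (n - x) \<le> 2 * y\<close>.\<close>
      have "u ^ (2 * min x y) \<le> u ^ (y + (n - x))"
        using u True True' xy by (intro power_decreasing) auto
      also have "\<dots> \<le> u ^ y * u ^ (n - x) + u ^ x * u ^ (n - y)" using u by (simp add: power_add)
      finally show ?thesis using le ne unfolding card x_def[symmetric] y_def[symmetric] by simp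
    next
      case False
      have "u ^ (2 * min x y) \<le> u ^ (x + (n - y))"
        using u True False xy by (intro power_decreasing) auto
      also have "\<dots> \<le> u ^ y * u ^ (n - x) + u ^ x * u ^ (n - y)" using u by (simp add: power_add)
      finally show ?thesis using le ne unfolding card x_def[symmetric] y_def[symmetric] by simp
    qed
  qed
qed

text \<open>Union bound over all pairs of port sets; each of the two symmetric sums is at most
  \<open>6 * (n * no_factor_base)\<close>.\<close>

lemma prob_no_factor:
  assumes bk: "b * d + d \<le> k" and u1: "n * no_factor_base \<le> 1"
  shows "expect k (\<lambda>a. of_bool (\<not> has_factor n \<kappa> (arr a b))) \<le> 12 * (n * no_factor_base)"
proof -
  define u where "u = no_factor_base"
  have u0: "u \<ge> 0" by (simp add: u_def no_factor_base_def)
  let ?R = "\<lambda>(X,Y) a. (\<Sum>i\<in>X. \<Sum>j\<in>Y. arr a b i j) + \<kappa> * card (ports - Y) < \<kappa> * card X"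
  let ?g = "\<lambda>X Y. of_bool (Y \<noteq> {}) * u ^ card Y * u ^ card (ports - X)"
  have "expect k (\<lambda>a. of_bool (\<not> has_factor n \<kappa> (arr a b))) \<le>
      (\<Sum>p\<in>Pow ports \<times> Pow ports. expect k (\<lambda>a. of_bool (?R p a)))"
    by (rule expectation_union_bound) (use no_factor_cut in fastforce)+
  also have "\<dots> \<le> (\<Sum>(X,Y)\<in>Pow ports \<times> Pow ports. ?g X Y + ?g Y X)"
  proof (rule sum_mono, clarify, goal_cases)
    case (1 X Y)
    show ?case using prob_cut[OF 1 bk] by (simp add: u_def)
  qed
  also have "\<dots> = (\<Sum>(X,Y)\<in>Pow ports \<times> Pow ports. ?g X Y) + (\<Sum>(X,Y)\<in>Pow ports \<times> Pow ports. ?g Y X)"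
    by (simp add: sum.distrib split_beta)
  also have "(\<Sum>(X,Y)\<in>Pow ports \<times> Pow ports. ?g Y X) = (\<Sum>X\<in>Pow ports. \<Sum>Y\<in>Pow ports. ?g Y X)"
    by (rule sum.cartesian_product[symmetric])
  also have "\<dots> = (\<Sum>Y\<in>Pow ports. \<Sum>X\<in>Pow ports. ?g Y X)"
    by (rule sum.swap)
  also have "\<dots> = (\<Sum>(X,Y)\<in>Pow ports \<times> Pow ports. ?g X Y)"
    by (rule sum.cartesian_product)
  also have "(\<Sum>(X,Y)\<in>Pow ports \<times> Pow ports. ?g X Y) \<le> 6 * (card ports * u)"
    using u0 u1 by (intro sum_pair_cards_le) (auto simp: u_def)
  finally show ?thesis by (simp add: u_def)
qed

lemma expect_add: "expect k (\<lambda>a. f a + g a) = expect k f + expect k g"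
  by (intro Bochner_Integration.integral_add) auto

section \<open>Overloaded ports and the probability of a bad batch\<close>

lemma sum_windows:
  fixes f :: "nat \<Rightarrow> nat"
  shows "(\<Sum>b\<in>{p..<p+B'}. \<Sum>t\<in>{b*d<..b*d+d}. f t) = (\<Sum>t\<in>{p*d<..(p+B')*d}. f t)"
proof (induction B')
  case (Suc B')
  have "{p*d<..(p+Suc B')*d} = {p*d<..(p+B')*d} \<union> {(p+B')*d<..(p+B')*d+d}"
    by (auto simp: algebra_simps)
  moreover have "{p*d<..(p+B')*d} \<inter> {(p+B')*d<..(p+B')*d+d} = {}" by auto
  ultimately show ?case using Suc by (simp add: sum.union_disjoint)
qed simp

lemma batch_eq: "batch a m i j = (\<Sum>t\<in>{m*B*d<..(m*B+B)*d}. of_bool (a (t, i, j)))"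
  unfolding batch_def arr_def by (rule sum_windows)

text \<open>Upper tail at \<open>B * d\<close> for a count of mean \<open>\<rho> * (B * d)\<close>,
  with tilt \<open>(1 - \<rho>) / 2\<close>. A general cell set \<open>Z\<close> serves rows and
  columns alike.\<close>

lemma prob_overload:
  assumes Z: "Z \<subseteq> slots k" "card Z = n * (B * d)"
    and P: "\<And>a. P a \<Longrightarrow> real (B * d) \<le> (\<Sum>z\<in>Z. of_bool (a z))"
  shows "expect k (\<lambda>a. of_bool (P a)) \<le> exp (- ((1 - \<rho>)\<^sup>2 * (B * d) / 4))"
proof -
  define \<epsilon> where "\<epsilon> = 1 - \<rho>"
  define s where "s = \<epsilon> / 2"
  have \<epsilon>: "0 < \<epsilon>" "\<epsilon> < 1" using \<rho> by (auto simp: \<epsilon>_def)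
  hence s: "0 \<le> s" "s \<le> 1" by (auto simp: s_def)
  define T where "T = real (B * d)"
  have T: "T \<ge> 0" by (simp add: T_def)
  have "expect k (\<lambda>a. of_bool (P a)) \<le> exp (\<rho> / n * card Z * (exp s - 1) - s * T)"
  proof (rule chernoff_count)
    show "s * T \<le> s * (\<Sum>z\<in>Z. of_bool (a z))" if "P a" for a
      using P[OF that] s by (intro mult_left_mono) (auto simp: T_def)
  qed (use Z rate in auto)
  also have "\<rho> / n * card Z = \<rho> * T" using n_pos by (simp add: Z T_def)
  also have "\<rho> * T * (exp s - 1) - s * T \<le> - (\<epsilon>\<^sup>2 * T / 4)"
  proof -
    have "\<rho> * T * (exp s - 1) \<le> \<rho> * T * (s + s\<^sup>2)"
      using exp_bound[OF s] \<rho> T by (intro mult_left_mono) auto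
    hence "\<rho> * T * (exp s - 1) - s * T \<le> T * (s * (\<rho> * (1 + s) - 1))"
      by (simp add: algebra_simps power2_eq_square)
    also have "\<dots> \<le> T * (s * (- \<epsilon> / 2))"
    proof (intro mult_left_mono)
      have "\<rho> * (1 + s) - 1 = - \<epsilon> / 2 - \<epsilon>\<^sup>2 / 2"
        by (simp add: s_def \<epsilon>_def field_simps power2_eq_square)
      thus "\<rho> * (1 + s) - 1 \<le> - \<epsilon> / 2" using zero_le_power2[of \<epsilon>] by linarith
    qed (use s T in auto)
    also have "\<dots> = - (\<epsilon>\<^sup>2 * T / 4)" by (simp add: s_def power2_eq_square)
    finally show ?thesis .
  qed
  finally show ?thesis by (simp add: \<epsilon>_def T_def)
qed

text \<open>A union bound: \<open>B\<close> windows may lack a factor and \<open>2 * n\<close> ports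
  may be overloaded.\<close>

definition bad_bound :: real where
  "bad_bound = B * (12 * (n * no_factor_base)) + 2 * n * exp (- ((1 - \<rho>)\<^sup>2 * (B * d) / 4))"

lemma bad_bound_nonneg: "0 \<le> bad_bound"
  by (simp add: bad_bound_def no_factor_base_def)

lemma prob_bad:
  assumes k: "Suc m * (B * d) \<le> k" and u1: "n * no_factor_base \<le> 1"
  shows "expect k (\<lambda>a. of_bool (bad a m)) \<le> bad_bound"
proof -
  let ?W = "{m*B..<m*B+B}"
  let ?r = "exp (- ((1 - \<rho>)\<^sup>2 * (B * d) / 4))"
  define F where "F a \<longleftrightarrow> (\<exists>b\<in>?W. \<not> has_factor n \<kappa> (arr a b))" for a
  define R where "R a \<longleftrightarrow> (\<exists>i\<in>ports. B * d \<le> (\<Sum>j\<in>ports. batch a m i j))" for a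
  define C where "C a \<longleftrightarrow> (\<exists>j\<in>ports. B * d \<le> (\<Sum>i\<in>ports. batch a m i j))" for a
  have k': "(m*B+B)*d \<le> k" using k by (simp add: algebra_simps)
  have "B * d > 0" using B_pos d_pos by simp
  hence le: "x \<le> B * d - 1 \<longleftrightarrow> \<not> B * d \<le> x" for x by linarith
  have bad: "bad a m \<longleftrightarrow> F a \<or> R a \<or> C a" for a
    unfolding bad_def deg_le_def F_def R_def C_def le by blast
  have "expect k (\<lambda>a. of_bool (bad a m)) \<le> expect k (\<lambda>a. of_bool (F a) + of_bool (R a) + of_bool (C a))"
    by (rule expect_mono) (simp add: bad)
  also have "\<dots> = expect k (\<lambda>a. of_bool (F a)) + expect k (\<lambda>a. of_bool (R a)) + expect k (\<lambda>a. of_bool (C a))"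
    by (simp add: Bochner_Integration.integral_add)
  also have "expect k (\<lambda>a. of_bool (F a)) \<le> (\<Sum>b\<in>?W. expect k (\<lambda>a. of_bool (\<not> has_factor n \<kappa> (arr a b))))"
    by (rule expectation_union_bound) (auto simp: F_def)
  also have "\<dots> \<le> (\<Sum>b\<in>?W. 12 * (n * no_factor_base))"
  proof (intro sum_mono prob_no_factor[OF _ u1])
    fix b assume "b \<in> ?W"
    hence "Suc b * d \<le> (m*B+B)*d" by (intro mult_le_mono1) auto
    thus "b * d + d \<le> k" using k' by simp
  qed
  also have "\<dots> = B * (12 * (n * no_factor_base))" by simp
  also have "expect k (\<lambda>a. of_bool (R a)) \<le>
      (\<Sum>i\<in>ports. expect k (\<lambda>a. of_bool (B * d \<le> (\<Sum>j\<in>ports. batch a m i j))))"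
    by (rule expectation_union_bound) (auto simp: R_def)
  also have "\<dots> \<le> (\<Sum>i\<in>ports. ?r)"
  proof (intro sum_mono prob_overload)
    fix i assume i: "i \<in> ports"
    let ?Z = "{m*B*d<..(m*B+B)*d} \<times> {i} \<times> ports"
    show "?Z \<subseteq> slots k" using k' i by auto
    show "card ?Z = n * (B * d)" by (simp add: card_cartesian_product algebra_simps)
    have "real (\<Sum>j\<in>ports. batch a m i j) = (\<Sum>z\<in>?Z. of_bool (a z))" for a
      unfolding batch_eq
      by (subst sum.swap) (simp add: sum.cartesian_product' del: sum_of_bool_eq)
    thus "real (B * d) \<le> (\<Sum>z\<in>?Z. of_bool (a z))" if "B * d \<le> (\<Sum>j\<in>ports. batch a m i j)" for a
      using that by (metis of_nat_le_iff)
  qed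
  also have "\<dots> = n * ?r" by simp
  also have "expect k (\<lambda>a. of_bool (C a)) \<le>
      (\<Sum>j\<in>ports. expect k (\<lambda>a. of_bool (B * d \<le> (\<Sum>i\<in>ports. batch a m i j))))"
    by (rule expectation_union_bound) (auto simp: C_def)
  also have "\<dots> \<le> (\<Sum>j\<in>ports. ?r)"
  proof (intro sum_mono prob_overload)
    fix j assume j: "j \<in> ports"
    let ?Z = "{m*B*d<..(m*B+B)*d} \<times> ports \<times> {j}"
    show "?Z \<subseteq> slots k" using k' j by auto
    show "card ?Z = n * (B * d)" by (simp add: card_cartesian_product algebra_simps)
    have "real (\<Sum>i\<in>ports. batch a m i j) = (\<Sum>z\<in>?Z. of_bool (a z))" for a
      unfolding batch_eq
      by (subst sum.swap) (simp add: sum.cartesian_product' del: sum_of_bool_eq)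
    thus "real (B * d) \<le> (\<Sum>z\<in>?Z. of_bool (a z))" if "B * d \<le> (\<Sum>i\<in>ports. batch a m i j)" for a
      using that by (metis of_nat_le_iff)
  qed
  also have "\<dots> = n * ?r" by simp
  finally show ?thesis by (simp add: bad_bound_def)
qed

section \<open>Exponential Lyapunov function for the excess\<close>

definition decay :: real where "decay = 1 / (real n * (B * d))"

lemma decay: "0 < decay" "decay \<le> 1"
proof -
  have "0 < n * (B * d)" using n_pos B_pos d_pos by simp
  hence "1 \<le> n * (B * d)" by simp
  hence "real 1 \<le> real (n * (B * d))" by (rule of_nat_mono)
  thus "0 < decay" "decay \<le> 1" by (auto simp: decay_def divide_simps)
qed

text \<open>An upper bound for the exponential Lyapunov function \<open>exp (decay * excess) - 1\<close>, which contracts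
  over a good batch and grows at most by the factor \<open>exp 1 \<le> 3\<close> over a bad one.\<close>

primrec potential :: "arrivals \<Rightarrow> nat \<Rightarrow> real" where
  "potential a 0 = 0"
| "potential a (Suc m) = exp (- decay) * potential a m + of_bool (bad a m) * (3 * potential a m + 2)"

lemma potential_nonneg: "0 \<le> potential a m"
  by (induction m) auto

lemma exp_excess_le: "exp (decay * excess a m) - 1 \<le> potential a m"
proof (induction m)
  case (Suc m)
  show ?case
  proof (cases "bad a m")
    case True
    \<comment> \<open>The scale \<open>decay\<close> is chosen so that the jump of
      \<open>excess\<close> in a bad batch multiplies the exponential by exactly
      \<open>exp 1\<close>.\<close>
    have "decay * (n * (B * d)) = 1"
      using n_pos B_pos d_pos by (simp add: decay_def)
    hence "exp (decay * excess a (Suc m)) = exp 1 * exp (decay * excess a m)"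
      using True by (simp add: distrib_left mult_exp_exp add.commute)
    also have "\<dots> \<le> 3 * (potential a m + 1)"
      using Suc exp_le by (intro mult_mono) auto
    finally have "exp (decay * excess a (Suc m)) - 1 \<le> 3 * potential a m + 2" by simp
    moreover have "0 \<le> exp (- decay) * potential a m" using potential_nonneg by simp
    ultimately show ?thesis using True by (simp del: excess.simps)
  next
    case False
    show ?thesis
    proof (cases "excess a m")
      case 0 thus ?thesis using False potential_nonneg by simp
    next
      case (Suc y)
      \<comment> \<open>Replacing 1 by the smaller \<open>exp (- decay)\<close> makes the
        contraction purely multiplicative.\<close>
      have "exp (decay * y) - 1 \<le> exp (decay * y) - exp (- decay)" using decay by simp
      also have "\<dots> = exp (- decay) * (exp (decay * excess a m) - 1)"
        using Suc by (simp add: algebra_simps flip: exp_add)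
      also have "\<dots> \<le> exp (- decay) * potential a m" using Suc.IH by (intro mult_left_mono) auto
      finally show ?thesis using False Suc by simp
    qed
  qed
qed simp

lemma excess_le_potential: "decay * excess a m \<le> potential a m"
  using exp_excess_le[of a m] exp_ge_add_one_self[of "decay * excess a m"] by linarith

text \<open>A batch is judged by its own arrivals only, while by \<open>potential_cong\<close> the
  potential sees earlier batches only; hence the two are independent.\<close>

lemma bad_cong:
  assumes "\<And>t i j. m * (B * d) < t \<Longrightarrow> t \<le> Suc m * (B * d) \<Longrightarrow> i \<in> ports \<Longrightarrow> j \<in> ports \<Longrightarrow> a (t, i, j) = a' (t, i, j)"
  shows "bad a m \<longleftrightarrow> bad a' m"
proof -
  have arr: "arr a b i j = arr a' b i j" if "b \<in> {m*B..<m*B+B}" "i \<in> ports" "j \<in> ports" for b i j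
    unfolding arr_def
  proof (intro sum.cong refl arg_cong[where f = of_bool])
    fix t assume t: "t \<in> {b*d<..b*d+d}"
    have *: "Suc b * d \<le> Suc m * B * d" "m * B * d \<le> b * d" using that by (intro mult_le_mono1; simp)+
    have "t \<le> Suc b * d" "b * d < t" using t by auto
    hence "t \<le> Suc m * B * d" "m * B * d < t"
      using le_trans[OF _ *(1)] le_less_trans[OF *(2)] by blast+
    thus "a (t, i, j) = a' (t, i, j)"
      using that by (intro assms) (simp_all only: mult.assoc)
  qed
  have "has_factor n \<kappa> (arr a b) \<longleftrightarrow> has_factor n \<kappa> (arr a' b)" if "b \<in> {m*B..<m*B+B}" for b
    using arr[OF that] by (rule has_factor_cong)
  moreover have "deg_le n (batch a m) D \<longleftrightarrow> deg_le n (batch a' m) D" for D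
    by (rule deg_le_cong) (auto simp: batch_def arr intro!: sum.cong)
  ultimately show ?thesis by (auto simp: bad_def)
qed

lemma potential_cong:
  assumes "\<And>t i j. 0 < t \<Longrightarrow> t \<le> m * (B * d) \<Longrightarrow> i \<in> ports \<Longrightarrow> j \<in> ports \<Longrightarrow> a (t, i, j) = a' (t, i, j)"
  shows "potential a m = potential a' m"
  using assms
proof (induction m)
  case (Suc m)
  have "potential a m = potential a' m" using Suc.prems by (intro Suc.IH) auto
  moreover have "bad a m \<longleftrightarrow> bad a' m" using Suc.prems by (intro bad_cong) auto
  ultimately show ?case by simp
qed simp

text \<open>By independence the mean \<open>E\<close> becomes at most
  \<open>(1 - decay / 2) * E + (3 * E + 2) * bad_bound\<close>. The hypothesis turns this into a
  contraction by \<open>1 - decay / 4\<close> plus \<open>2 * bad_bound\<close>, with fixed point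
  \<open>8 * bad_bound / decay\<close>.\<close>

lemma expect_potential:
  assumes u1: "n * no_factor_base \<le> 1" and p: "12 * bad_bound \<le> decay\<^sup>2"
    and "m * (B * d) \<le> k"
  shows "expect k (\<lambda>a. potential a m) \<le> 8 * bad_bound / decay"
  using assms(3)
proof (induction m)
  case 0
  thus ?case using bad_bound_nonneg decay by simp
next
  case (Suc m)
  define E where "E = expect k (\<lambda>a. potential a m)"
  have E: "E \<le> 8 * bad_bound / decay" using Suc by (simp add: E_def)
  have E0: "0 \<le> E" unfolding E_def by (simp add: potential_nonneg)
  let ?A = "slots (m * (B * d))"
  have indep: "expect k (\<lambda>a. (3 * potential a m + 2) * of_bool (bad a m)) =
      expect k (\<lambda>a. 3 * potential a m + 2) * expect k (\<lambda>a. of_bool (bad a m))"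
  proof (rule expectation_bernoulli_field_mult[where A = ?A])
    show "?A \<subseteq> slots k" using Suc.prems by auto
    fix a a' :: arrivals
    show "3 * potential a m + 2 = 3 * potential a' m + 2" if "\<And>x. x \<in> ?A \<Longrightarrow> a x = a' x"
      using potential_cong[of m a a'] that by auto
    show "of_bool (bad a m) = (of_bool (bad a' m) :: real)" if "\<And>x. x \<in> slots k - ?A \<Longrightarrow> a x = a' x"
    proof -
      have "bad a m \<longleftrightarrow> bad a' m"
        using Suc.prems by (intro bad_cong that) auto
      thus ?thesis by simp
    qed
  qed auto
  have "expect k (\<lambda>a. potential a (Suc m)) =
      exp (- decay) * E + expect k (\<lambda>a. (3 * potential a m + 2) * of_bool (bad a m))"
    by (simp add: E_def Bochner_Integration.integral_add mult.commute)
  also have "\<dots> = exp (- decay) * E + (3 * E + 2) * expect k (\<lambda>a. of_bool (bad a m))"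
    unfolding indep by (simp add: E_def Bochner_Integration.integral_add)
  also have "\<dots> \<le> exp (- decay) * E + (3 * E + 2) * bad_bound"
    using prob_bad[OF Suc.prems u1] E0 by (intro add_left_mono mult_left_mono) auto
  also have "exp (- decay) * E \<le> (1 - decay / 2) * E"
  proof (intro mult_right_mono E0)
    have "exp (- decay) \<le> 1 / (1 + decay)"
      using exp_ge_add_one_self[of decay] decay by (simp add: exp_minus divide_simps)
    also have "\<dots> \<le> 1 - decay / 2"
    proof -
      have "1 \<le> (1 - decay / 2) * (1 + decay)" using decay mult_left_le[of decay decay] by (simp add: algebra_simps)
      thus ?thesis using decay by (simp add: divide_simps)
    qed
    finally show "exp (- decay) \<le> 1 - decay / 2" .
  qed
  also have "(3 * E + 2) * bad_bound = E * (3 * bad_bound) + 2 * bad_bound" by (simp add: algebra_simps)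
  also have "E * (3 * bad_bound) \<le> E * (decay / 4)"
  proof (intro mult_left_mono E0)
    have "decay\<^sup>2 \<le> decay" using decay by (simp add: power2_eq_square mult_left_le)
    thus "3 * bad_bound \<le> decay / 4" using p by linarith
  qed
  also have "(1 - decay / 2) * E + (E * (decay / 4) + 2 * bad_bound) = (1 - decay / 4) * E + 2 * bad_bound"
    by (simp add: algebra_simps)
  also have "(1 - decay / 4) * E \<le> (1 - decay / 4) * (8 * bad_bound / decay)"
    using E decay by (intro mult_left_mono) auto
  also have "\<dots> + 2 * bad_bound = 8 * bad_bound / decay" using decay by (simp add: field_simps)
  finally show ?case by simp
qed

text \<open>Dividing the potential by \<open>decay\<close> once more gives
  \<open>8 * bad_bound / decay\<^sup>2\<close>, whence the square in the hypothesis.\<close>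

lemma expect_excess:
  assumes "n * no_factor_base \<le> 1" and p: "12 * bad_bound \<le> decay\<^sup>2" and "m * (B * d) \<le> k"
  shows "expect k (\<lambda>a. real (excess a m)) \<le> 1"
proof -
  have "expect k (\<lambda>a. real (excess a m)) \<le> expect k (\<lambda>a. potential a m / decay)"
    using excess_le_potential decay by (intro expect_mono) (simp add: field_simps)
  also have "\<dots> = expect k (\<lambda>a. potential a m) / decay" by simp
  also have "\<dots> \<le> 8 * bad_bound / decay / decay"
    using expect_potential[OF assms] decay by (intro divide_right_mono) auto
  also have "\<dots> \<le> 1"
    using p bad_bound_nonneg decay by (simp add: field_simps power2_eq_square)
  finally show ?thesis .
qed

section \<open>Expected total queue size\<close>

lemma expect_sum_arr:
  assumes "b * d + d \<le> k"
  shows "expect k (\<lambda>a. real (\<Sum>i\<in>ports. \<Sum>j\<in>ports. arr a b i j)) = \<rho> * d * n"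
proof -
  have "expect k (\<lambda>a. \<Sum>z\<in>{b*d<..b*d+d} \<times> ports \<times> ports. of_bool (a z)) =
      \<rho> / n * card ({b*d<..b*d+d} \<times> ports \<times> ports)"
    using assms rate by (intro expectation_count) auto
  thus ?thesis unfolding sum_arr using n_pos by (simp add: card_cartesian_product)
qed

lemma expect_sum_recent: "expect k (\<lambda>a. real (\<Sum>i\<in>ports. \<Sum>j\<in>ports. recent a k i j)) \<le> d * n"
proof -
  let ?Z = "{k div d * d<..k} \<times> ports \<times> ports"
  have "(\<Sum>i\<in>ports. \<Sum>j\<in>ports. recent a k i j) =
      (\<Sum>t\<in>{k div d * d<..k}. \<Sum>i\<in>ports. \<Sum>j\<in>ports. of_bool (a (t, i, j)))" for a
  proof -
    have "(\<Sum>i\<in>ports. \<Sum>j\<in>ports. recent a k i j) =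
        (\<Sum>i\<in>ports. \<Sum>t\<in>{k div d * d<..k}. \<Sum>j\<in>ports. of_bool (a (t, i, j)))"
      unfolding recent_def by (intro sum.cong refl sum.swap)
    thus ?thesis by (simp only: sum.swap[of _ "{k div d * d<..k}"])
  qed
  hence "real (\<Sum>i\<in>ports. \<Sum>j\<in>ports. recent a k i j) = (\<Sum>z\<in>?Z. of_bool (a z))" for a
    by (simp add: sum.cartesian_product split_beta del: sum_of_bool_eq)
  hence "expect k (\<lambda>a. real (\<Sum>i\<in>ports. \<Sum>j\<in>ports. recent a k i j)) = expect k (\<lambda>a. \<Sum>z\<in>?Z. of_bool (a z))"
    by simp
  also have "\<dots> = \<rho> / n * card ?Z"
    using rate by (intro expectation_count) auto
  also have "\<dots> = \<rho> * (n * (k mod d))"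
    using n_pos by (simp add: card_cartesian_product minus_div_mult_eq_mod)
  also have "\<dots> \<le> 1 * real (n * d)"
  proof (rule mult_mono)
    have "k mod d \<le> d" using d_pos by (simp add: less_imp_le)
    thus "real (n * (k mod d)) \<le> real (n * d)" by (intro of_nat_mono mult_left_mono) auto
  qed (use \<rho> in auto)
  finally show ?thesis by (simp add: mult.commute)
qed

text \<open>Per port, the pool contributes \<open>spare + 1\<close>, the factor in service
  \<open>d\<close>, the backlog \<open>spare + 1\<close> and the current window \<open>d\<close>. In
  the backlog, \<open>u2\<close> pays for windows without a factor.\<close>

lemma expect_total_queue_le:
  assumes u1: "n * no_factor_base \<le> 1" and p: "12 * bad_bound \<le> decay\<^sup>2"
    and u2: "B * \<kappa> * (12 * (n * no_factor_base)) \<le> 1"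
  shows "expect k (\<lambda>a. real (\<Sum>i\<in>ports. \<Sum>j\<in>ports. qstate batch_policy a k i j)) \<le> n * (2 * spare + 2 * d + 2)"
proof -
  define m where "m = k div (B * d)"
  define p0 where "p0 = 12 * (n * no_factor_base)"
  define W where "W = {k div d div B * B..<k div d}"
  have mk: "m * (B * d) \<le> k" unfolding m_def by (rule div_times_less_eq_dividend)
  let ?arr = "\<lambda>a b. real (\<Sum>i\<in>ports. \<Sum>j\<in>ports. arr a b i j) - real (n * \<kappa>) * of_bool (has_factor n \<kappa> (arr a b))"
  define R where "R a = real (\<Sum>i\<in>ports. \<Sum>j\<in>ports. recent a k i j)" for a
  have "expect k (\<lambda>a. real (\<Sum>i\<in>ports. \<Sum>j\<in>ports. qstate batch_policy a k i j)) \<le>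
      expect k (\<lambda>a. real n * (spare + excess a m) + real n * d + (\<Sum>b\<in>W. ?arr a b) + R a)"
    unfolding m_def W_def R_def by (rule expect_mono) (rule total_queue_le)
  also have "\<dots> = expect k (\<lambda>a. real n * (spare + excess a m)) + expect k (\<lambda>a. real n * d)
      + expect k (\<lambda>a. \<Sum>b\<in>W. ?arr a b) + expect k R"
    by (simp only: expect_add)
  also have "expect k (\<lambda>a. real n * d) = real n * d"
    by simp
  also have "expect k (\<lambda>a. real n * (spare + excess a m)) = n * (spare + expect k (\<lambda>a. real (excess a m)))"
    by (simp add: expect_add)
  also have "expect k (\<lambda>a. \<Sum>b\<in>W. ?arr a b) = (\<Sum>b\<in>W. expect k (\<lambda>a. ?arr a b))"
    by (rule Bochner_Integration.integral_sum) simp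
  also have "(\<Sum>b\<in>W. expect k (\<lambda>a. ?arr a b)) \<le> (\<Sum>b\<in>W. n * (d - \<kappa>) + n * \<kappa> * p0)"
  proof (rule sum_mono)
    fix b assume "b \<in> W"
    hence "Suc b * d \<le> k div d * d" by (intro mult_le_mono1) (auto simp: W_def)
    also have "\<dots> \<le> k" by (rule div_times_less_eq_dividend)
    finally have bk: "b * d + d \<le> k" by simp
    define S N where "S a = real (\<Sum>i\<in>ports. \<Sum>j\<in>ports. arr a b i j)"
      and "N a = (of_bool (\<not> has_factor n \<kappa> (arr a b)) :: real)" for a
    have "?arr a b = S a - n * \<kappa> + n * \<kappa> * N a" for a
      by (cases "has_factor n \<kappa> (arr a b)") (simp_all only: S_def N_def, simp_all)
    hence "expect k (\<lambda>a. ?arr a b) = expect k (\<lambda>a. S a - n * \<kappa> + n * \<kappa> * N a)"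
      by presburger
    also have "\<dots> = expect k S - n * \<kappa> + n * \<kappa> * expect k N"
      by (simp add: Bochner_Integration.integral_add Bochner_Integration.integral_diff)
    also have "expect k S = \<rho> * d * n"
      unfolding S_def by (rule expect_sum_arr[OF bk])
    also have "\<rho> * d * n - n * \<kappa> + n * \<kappa> * expect k N \<le> 1 * real d * n - real (n * \<kappa>) + n * \<kappa> * p0"
      using prob_no_factor[OF bk u1] \<rho> unfolding p0_def N_def
      by (intro add_mono diff_right_mono mult_left_mono mult_right_mono) auto
    also have "\<dots> = n * (d - \<kappa>) + n * \<kappa> * p0"
      using \<kappa>_less by (simp add: of_nat_diff algebra_simps)
    finally show "expect k (\<lambda>a. ?arr a b) \<le> n * (d - \<kappa>) + n * \<kappa> * p0" .
  qed
  also have "\<dots> = card W * (n * (d - \<kappa>) + n * \<kappa> * p0)" by simp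
  also have "\<dots> \<le> B * (n * (d - \<kappa>) + n * \<kappa> * p0)"
  proof (rule mult_right_mono)
    have "card W = k div d mod B" by (simp add: W_def minus_div_mult_eq_mod)
    thus "real (card W) \<le> B" using B_pos by (simp add: less_imp_le)
  qed (simp add: p0_def no_factor_base_def)
  also have "\<dots> = n * spare + n * (B * \<kappa> * p0)" by (simp add: spare_def distrib_left mult_ac)
  also have "n * (B * \<kappa> * p0) \<le> real n * 1" using u2[folded p0_def] by (rule mult_left_mono) simp
  also have "expect k R \<le> d * n" unfolding R_def by (rule expect_sum_recent)
  also have "n * (spare + expect k (\<lambda>a. real (excess a m))) \<le> n * (real spare + 1)"
    using expect_excess[OF u1 p mk] by (intro mult_left_mono) auto
  finally show ?thesis by (simp add: distrib_left mult_ac)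
qed

end

section \<open>Choice of the parameters\<close>

text \<open>In powers of \<open>x\<close>, with \<open>x ^ 3 = 1 / \<epsilon>\<close>, the orders
  are \<open>d ~ L x^4\<close>, \<open>\<eta> ~ L x^2\<close>, \<open>B ~ x^2\<close>, so
  \<open>spare ~ L x^4\<close> as well. For \<open>n \<ge> 2\<close> one has
  \<open>L \<ge> 1 / 2\<close>, and rounding errors are absorbed by \<open>Lx\<close>.\<close>

lemma switch_ge_2:
  fixes n :: nat and \<rho> :: real
  assumes n: "n \<ge> 2" and \<rho>: "0 < \<rho>" "\<rho> < 1"
  shows "\<exists>pol. valid_policy n pol \<and> (\<forall>tau\<ge>1. expected_total_queue n \<rho> pol tau
    \<le> 32900 * real n * (1 - \<rho>) powr (-4/3) * ln (max (real n) (1 / (1 - \<rho>))))"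
proof -
  define \<epsilon> where "\<epsilon> = 1 - \<rho>"
  define f where "f = max (real n) (1 / \<epsilon>)"
  define L where "L = ln f"
  define x where "x = \<epsilon> powr (-1/3)"
  define d where "d = nat \<lceil>L * x ^ 4\<rceil>"
  \<comment> \<open>\<open>252 = 4 * 63\<close> makes the overload exponent at least
    \<open>63 * L\<close>.\<close>
  define B where "B = nat \<lceil>252 * x\<^sup>2\<rceil>"
  \<comment> \<open>\<open>60 * 60 = 75 * 16 * 3\<close>, where 3 comes from
    \<open>d \<le> 3 * L * x ^ 4\<close>; this yields the exponent 75 in \<open>u\<close>.\<close>
  define \<eta> where "\<eta> = 60 * L * x\<^sup>2"
  \<comment> \<open>If \<open>\<rho> * d < \<eta>\<close>, then \<open>nat\<close> truncates to
    \<open>\<kappa> = 0\<close> and the gap condition of the locale is vacuous.\<close>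
  define \<kappa> where "\<kappa> = nat \<lfloor>\<rho> * d - \<eta>\<rfloor>"
  have \<epsilon>: "0 < \<epsilon>" "\<epsilon> < 1" using \<rho> by (auto simp: \<epsilon>_def)
  have f: "f \<ge> 2" "n \<le> f" "1 / \<epsilon> \<le> f" using n by (auto simp: f_def)
  have L: "L \<ge> 1 / 2"
  proof -
    have "1 / 2 \<le> ln (2 :: real)" using ln2_ge_two_thirds by simp
    also have "\<dots> \<le> L" unfolding L_def using f by (intro ln_mono) auto
    finally show ?thesis .
  qed
  have Lf: "L \<le> f" unfolding L_def using f ln_le_minus_one[of f] by linarith
  have x1: "x \<ge> 1" unfolding x_def using \<epsilon> by (simp add: powr_minus field_simps powr_le1)
  have x3: "x ^ 3 = 1 / \<epsilon>"
    using \<epsilon> by (simp add: x_def powr_power powr_minus divide_simps)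
  have x4: "x ^ 4 = \<epsilon> powr (-4/3)"
    using \<epsilon> by (simp add: x_def powr_power)
  have pw: "x ^ i \<le> x ^ j" if "i \<le> j" for i j using that x1 by (rule power_increasing)
  have Lx: "1 \<le> 2 * L * x ^ i" for i
  proof -
    have "1 * 1 \<le> (2 * L) * x ^ i" using L x1 by (intro mult_mono) auto
    thus ?thesis by simp
  qed
  have d: "L * x ^ 4 \<le> d" "d \<le> 3 * L * x ^ 4"
  proof -
    have "0 < L * x ^ 4" using L x1 by simp
    hence "L * x ^ 4 \<le> d" "d \<le> L * x ^ 4 + 1" unfolding d_def by linarith+
    thus "L * x ^ 4 \<le> d" "d \<le> 3 * L * x ^ 4" using Lx[of 4] by linarith+
  qed
  have d0: "d > 0"
  proof -
    have "0 < L * x ^ 4" using L x1 by simp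
    thus ?thesis using d(1) by linarith
  qed
  have B: "252 * x\<^sup>2 \<le> B" "B \<le> 253 * x\<^sup>2"
  proof -
    have "1 \<le> x\<^sup>2" using x1 by simp
    thus "252 * x\<^sup>2 \<le> B" "B \<le> 253 * x\<^sup>2" unfolding B_def by linarith+
  qed
  have B0: "B > 0"
  proof -
    have "1 \<le> x\<^sup>2" using x1 by simp
    thus ?thesis using B(1) by linarith
  qed
  have \<eta>0: "\<eta> \<ge> 0" using L by (simp add: \<eta>_def)
  have \<rho>d: "\<rho> * d < d" using \<rho> d0 by simp
  have \<kappa>: "\<kappa> < d" using \<rho>d \<eta>0 d0 unfolding \<kappa>_def by linarith
  interpret loaded_switch n d \<kappa> B \<rho> \<eta>
  proof
    show "real \<kappa> + \<eta> \<le> \<rho> * d" if "\<kappa> > 0" using that unfolding \<kappa>_def by linarith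
  qed (use n \<rho> d0 B0 \<kappa> \<eta>0 in auto)
  \<comment> \<open>\<open>65 = 3 + 60 + 2\<close>: the terms come from
    \<open>\<epsilon> * d\<close>, from \<open>\<eta>\<close> and from rounding.\<close>
  have "d - \<kappa> \<le> 65 * L * x\<^sup>2"
  proof -
    have "real (d - \<kappa>) = d - real \<kappa>" using \<kappa> by (simp add: of_nat_diff)
    also have "\<dots> \<le> \<epsilon> * d + \<eta> + 1" unfolding \<kappa>_def \<epsilon>_def left_diff_distrib by linarith
    also have "\<epsilon> * d \<le> \<epsilon> * (3 * L * x ^ 4)" using d \<epsilon> by (intro mult_left_mono) auto
    also have "\<dots> = 3 * L * x * (\<epsilon> * x ^ 3)" by (simp add: power_numeral_reduce)
    also have "\<dots> = 3 * L * x" using x3 \<epsilon> by simp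
    also have "\<dots> \<le> 3 * L * x\<^sup>2" using pw[of 1 2] L by (intro mult_left_mono) auto
    finally show ?thesis using Lx[of 2] by (simp add: \<eta>_def)
  qed
  hence "real B * (d - \<kappa>) \<le> (253 * x\<^sup>2) * (65 * L * x\<^sup>2)"
    using B L by (intro mult_mono) auto
  hence spare: "real spare \<le> 16445 * (L * x ^ 4)" by (simp add: spare_def power_numeral_reduce mult_ac)
  have u: "no_factor_base \<le> 1 / f ^ 75"
  proof -
    have "75 * L * (16 * d) \<le> 75 * L * (16 * (3 * L * x ^ 4))"
      using d L by (intro mult_left_mono) auto
    also have "\<dots> = \<eta>\<^sup>2" by (simp add: \<eta>_def power_numeral_reduce)
    finally have "75 * L \<le> \<eta>\<^sup>2 / (16 * d)" using d0 by (simp add: pos_le_divide_eq)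
    hence "no_factor_base \<le> exp (- (75 * L))" by (simp add: no_factor_base_def)
    also have "\<dots> = inverse (exp L ^ 75)"
      by (simp add: exp_minus flip: exp_of_nat_mult)
    also have "exp L = f" using f by (simp add: L_def)
    finally show ?thesis by (simp add: inverse_eq_divide)
  qed
  have r: "exp (- ((1 - \<rho>)\<^sup>2 * (B * d) / 4)) \<le> 1 / f ^ 63"
  proof -
    have "252 * x\<^sup>2 * (L * x ^ 4) \<le> real B * d" using B d L by (intro mult_mono) auto
    hence "\<epsilon>\<^sup>2 * (252 * x\<^sup>2 * (L * x ^ 4)) \<le> \<epsilon>\<^sup>2 * (B * d)" by (intro mult_left_mono) auto
    moreover have "\<epsilon>\<^sup>2 * (252 * x\<^sup>2 * (L * x ^ 4)) = 252 * L * (\<epsilon> * x ^ 3)\<^sup>2"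
      by (simp add: power_numeral_reduce)
    moreover have "\<epsilon> * x ^ 3 = 1" using x3 \<epsilon> by simp
    ultimately have "252 * L \<le> \<epsilon>\<^sup>2 * (B * d)" by (simp only: power_one mult_1_right)
    hence "63 * L \<le> (1 - \<rho>)\<^sup>2 * (B * d) / 4" by (simp add: \<epsilon>_def)
    hence "exp (- ((1 - \<rho>)\<^sup>2 * (B * d) / 4)) \<le> exp (- (63 * L))" by simp
    also have "\<dots> = inverse (exp L ^ 63)"
      by (simp add: exp_minus flip: exp_of_nat_mult)
    also have "exp L = f" using f by (simp add: L_def)
    finally show ?thesis by (simp add: inverse_eq_divide)
  qed
  \<comment> \<open>Numerical constants are absorbed into powers of \<open>f\<close>, as
    \<open>f \<ge> 2\<close>.\<close>
  have fpow: "2 ^ k * y \<le> f ^ (k + l)" if "0 \<le> y" "y \<le> f ^ l" for k l y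
    unfolding power_add using that f by (intro mult_mono power_mono) auto
  have T: "real (B * d) \<le> f ^ 13"
  proof -
    have "real B * d \<le> 253 * x\<^sup>2 * (3 * L * x ^ 4)" using B d by (intro mult_mono) auto
    also have "\<dots> = 759 * (L * (x ^ 3)\<^sup>2)" by (simp add: power_numeral_reduce)
    also have "\<dots> \<le> 2 ^ 10 * (f * f\<^sup>2)"
      using L Lf f \<epsilon> unfolding x3 by (intro mult_mono power_mono) auto
    also have "\<dots> \<le> f ^ (10 + 3)" using f by (intro fpow) (auto simp: power_numeral_reduce)
    finally show ?thesis by simp
  qed
  have Bd: "real B \<le> real (B * d)" using d0 by (intro of_nat_mono) simp
  have B\<kappa>: "real (B * \<kappa>) \<le> real (B * d)" using \<kappa> by (intro of_nat_mono) simp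
  have u0: "0 \<le> no_factor_base" by (simp add: no_factor_base_def)
  have nu: "12 * (n * no_factor_base) \<le> f ^ 5 / f ^ 75"
  proof -
    have "12 * (n * no_factor_base) = (12 * real n) * no_factor_base" by simp
    also have "\<dots> \<le> f ^ 5 * (1 / f ^ 75)"
    proof (intro mult_mono u u0)
      have "12 * real n \<le> 2 ^ 4 * f" using f by simp
      also have "\<dots> \<le> f ^ (4 + 1)" using f by (intro fpow) auto
      finally show "12 * real n \<le> f ^ 5" by simp
    qed (use f in auto)
    finally show ?thesis by simp
  qed
  have pos: "f > 0" using f by simp
  have divf: "f ^ k / f ^ (k + l) = 1 / f ^ l" for k l using pos by (simp add: power_add)
  have le1: "1 / f ^ l \<le> 1" for l using f by simp
  have "real (B * \<kappa>) * (12 * (n * no_factor_base)) \<le> f ^ 13 * (f ^ 5 / f ^ 75)"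
    using T B\<kappa> nu u0 f by (intro mult_mono) auto
  also have "\<dots> = 1 / f ^ 57" using divf[of 18 57] by (simp flip: power_add)
  finally have u2: "real (B * \<kappa>) * (12 * (n * no_factor_base)) \<le> 1" using le1[of 57] by linarith
  have u1: "n * no_factor_base \<le> 1"
    using nu divf[of 5 70] le1[of 70] u0 by simp
  have "12 * bad_bound \<le> decay\<^sup>2"
  proof -
    have "real B * (12 * (n * no_factor_base)) \<le> f ^ 13 * (f ^ 5 / f ^ 75)"
      using T Bd nu u0 f by (intro mult_mono) auto
    also have "\<dots> = 1 / f ^ 57" using divf[of 18 57] by (simp flip: power_add)
    finally have 1: "real B * (12 * (n * no_factor_base)) \<le> 1 / f ^ 57" .
    have "2 * n * exp (- ((1 - \<rho>)\<^sup>2 * (B * d) / 4)) \<le> f\<^sup>2 * (1 / f ^ 63)"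
      using r f by (intro mult_mono) (auto simp: power2_eq_square intro!: mult_mono)
    also have "\<dots> = 1 / f ^ 61" using divf[of 2 61] by simp
    also have "\<dots> \<le> 1 / f ^ 57" using f by (intro divide_left_mono power_increasing) auto
    finally have "bad_bound \<le> 2 / f ^ 57" using 1 by (simp add: bad_bound_def)
    hence "12 * bad_bound \<le> 24 / f ^ 57" by simp
    also have "\<dots> \<le> f ^ 5 / f ^ 57" using f power_mono[of 2 f 5] by (intro divide_right_mono) auto
    also have "\<dots> = 1 / f ^ 52" using divf[of 5 52] by simp
    also have "\<dots> \<le> 1 / f ^ 28" using f by (intro divide_left_mono power_increasing) auto
    also have "\<dots> \<le> decay\<^sup>2"
    proof -
      \<comment> \<open>\<open>decay\<close> is at least \<open>f\<close> to the power -14, so its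
        square exceeds the failure bound, of order -52 in \<open>f\<close>, with ample room.\<close>
      have "real n * (B * d) \<le> f * f ^ 13" using f T by (intro mult_mono) auto
      hence "1 / (f * f ^ 13) \<le> decay"
        unfolding decay_def using n d0 B0 pos by (intro divide_left_mono) auto
      hence "(1 / (f * f ^ 13))\<^sup>2 \<le> decay\<^sup>2" using pos by (intro power_mono) auto
      moreover have "(1 / (f * f ^ 13))\<^sup>2 = 1 / f ^ 28"
        by (simp add: power_divide flip: power_Suc power_mult)
      ultimately show ?thesis by simp
    qed
    finally show ?thesis .
  qed
  note main = expect_total_queue_le[OF u1 this u2]
  have "expected_total_queue n \<rho> batch_policy tau \<le> 32900 * real n * (1 - \<rho>) powr (-4/3) * ln (max (real n) (1 / (1 - \<rho>)))"
    if "tau \<ge> 1" for tau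
  proof -
    have "expected_total_queue n \<rho> batch_policy tau \<le> n * (2 * spare + 2 * d + 2)"
      using main[of "tau - 1"] that by (simp add: expected_total_queue_def arrival_law_def Q_def)
    also have "\<dots> = real n * (2 * real spare + 2 * real d + 2)" by (simp add: distrib_left)
    \<comment> \<open>\<open>32900 = 2 * 16445 + 2 * 3 + 2 * 2\<close>.\<close>
    also have "\<dots> \<le> n * (32900 * (L * x ^ 4))"
      using spare d(2) Lx[of 4] by (intro mult_left_mono) auto
    finally show ?thesis by (simp add: x4 L_def f_def \<epsilon>_def mult_ac)
  qed
  thus ?thesis using valid_batch_policy by blast
qed

text \<open>For one port \<open>f\<close> may be close to 1, so the bound must vanish with
  \<open>\<rho>\<close>. Serving the queue in every slot leaves only the latest arrival, of mean
  \<open>\<rho> \<le> ln (1 / (1 - \<rho>))\<close>.\<close>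

lemma switch_1:
  fixes \<rho> :: real
  assumes \<rho>: "0 < \<rho>" "\<rho> < 1"
  shows "\<exists>pol. valid_policy 1 pol \<and> (\<forall>tau\<ge>1. expected_total_queue 1 \<rho> pol tau
    \<le> (1 - \<rho>) powr (-4/3) * ln (1 / (1 - \<rho>)))"
proof -
  define pol :: policy where "pol = (\<lambda>_ _ _ i j. i = 1 \<and> j = 1)"
  have "card {j. j = Suc 0 \<and> P} \<le> Suc 0" "card {j. P \<and> j = Suc 0} \<le> Suc 0" for P
    by (cases P; simp)+
  hence valid: "valid_policy 1 pol" by (simp add: valid_policy_def feasible_schedule_def pol_def)
  have q: "qstate pol a (Suc k) 1 1 = of_bool (a (Suc k, 1, 1))" for a k
    by (induction k) (auto simp: pol_def Let_def)
  have "\<rho> \<le> ln (1 / (1 - \<rho>))"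
    using \<rho> ln_le_minus_one[of "1 - \<rho>"] by (simp add: ln_div)
  moreover have "1 \<le> (1 - \<rho>) powr (-4/3)"
    using \<rho> by (simp add: powr_minus field_simps powr_le1)
  ultimately have \<rho>_le: "1 * \<rho> \<le> (1 - \<rho>) powr (-4/3) * ln (1 / (1 - \<rho>))"
    using \<rho> by (intro mult_mono) auto
  have "expected_total_queue 1 \<rho> pol tau \<le> \<rho>" if "tau \<ge> 1" for tau
  proof (cases "tau - 1")
    case 0
    thus ?thesis using \<rho> by (simp add: expected_total_queue_def Q_def)
  next
    case (Suc k)
    hence tau: "tau = Suc (Suc k)" by simp
    have "real (\<Sum>i\<in>{1..1}. \<Sum>j\<in>{1..1}. Q pol a tau i j) = (\<Sum>z\<in>{(Suc k, 1, 1)}. of_bool (a z))" for a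
      using q[of a k] by (simp add: Q_def tau del: qstate.simps sum_of_bool_eq)
    hence "expected_total_queue 1 \<rho> pol tau = measure_pmf.expectation
        (bernoulli_field ({1..<Suc (Suc k)} \<times> {1..1::nat} \<times> {1..1::nat}) \<rho>)
        (\<lambda>a. \<Sum>z\<in>{(Suc k, 1, 1)}. of_bool (a z))"
      unfolding expected_total_queue_def arrival_law_def tau by (simp only: of_nat_1 div_by_1)
    also have "\<dots> = \<rho> * card {(Suc k, 1::nat, 1::nat)}" using \<rho> by (intro expectation_count) auto
    finally show ?thesis by simp
  qed
  with \<rho>_le valid show ?thesis by fastforce
qed

theorem theorem3p1:
  shows "\<exists>c::real. c > 0 \<and>
    (\<forall>(n::nat) (rho::real). 0 < rho \<and> rho < 1 \<longrightarrow>
       (\<exists>pol. valid_policy n pol \<and>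
          (\<forall>tau::nat. tau \<ge> 1 \<longrightarrow>
             expected_total_queue n rho pol tau
               \<le> c * real n * (1 - rho) powr (-4/3) * ln (max (real n) (1 / (1 - rho))))))"
proof (intro exI[of _ 32900] conjI allI impI)
  fix n :: nat and \<rho> :: real
  assume \<rho>: "0 < \<rho> \<and> \<rho> < 1"
  show "\<exists>pol. valid_policy n pol \<and> (\<forall>tau. tau \<ge> 1 \<longrightarrow> expected_total_queue n \<rho> pol tau
    \<le> 32900 * real n * (1 - \<rho>) powr (-4/3) * ln (max (real n) (1 / (1 - \<rho>))))"
  proof (cases "n \<ge> 2")
    case True
    thus ?thesis using switch_ge_2 \<rho> by blast
  next
    case False
    then consider "n = 0" | "n = 1" by linarith
    thus ?thesis
    proof cases
      case 1
      have "valid_policy n (\<lambda>_ _ _ _ _. False)" by (simp add: valid_policy_def feasible_schedule_def)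
      moreover have "expected_total_queue n \<rho> pol tau = 0" for pol tau
        using 1 by (simp add: expected_total_queue_def)
      ultimately show ?thesis using 1 by fastforce
    next
      case 2
      have max: "max (real n) (1 / (1 - \<rho>)) = 1 / (1 - \<rho>)" using 2 \<rho> by (simp add: max_def)
      have "0 \<le> (1 - \<rho>) powr (-4/3) * ln (1 / (1 - \<rho>))" using \<rho> by simp
      hence "(1 - \<rho>) powr (-4/3) * ln (1 / (1 - \<rho>)) \<le> 32900 * real n * (1 - \<rho>) powr (-4/3) * ln (1 / (1 - \<rho>))"
        using 2 by (simp add: mult.commute)
      thus ?thesis using switch_1[of \<rho>] \<rho> unfolding max[unfolded 2] 2 by (meson order.trans)
    qed
  qed
qed simp

end
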